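(* Fix $\lambda\in[0,1)$ when $d\ge2$, and $\lambda\in(0,1)$ when $d=1$. Let $(X_n)_{n\ge 0}$ be the biased random walk $\mathrm{RW}_\lambda$ on $\mathbb{Z}^d$ started at any fixed point of $\mathbb{Z}^d$, $X_n=(X_n^1,\dots,X_n^d)$. (i) For any $d\in\mathbb{N}$, the sequence $\left\{\frac1n(|X_n^1|,\dots,|X_n^d|)\right\}_{n=1}^\infty$ satisfies the large deviation principle (with speed $n$) with the good rate function $$\Lambda^*(x)=\sup_{s\in\mathbb{R}^d}\{(s,x)-\ln\psi(s)\},\quad x\in\mathbb{R}^d.$$ In addition, when $\lambda\in(0,1)$, $$\mathcal{D}_{\Lambda^*}:=\{x\in\mathbb{R}^d:\Lambda^*(x)<\infty\}=\left\{x\in\mathbb{R}_+^d:\ 0\le\sum_{i=1}^dx_i\le1\right\},$$ $$\{x\in\mathbb{R}^d:\Lambda^*(x)=0\}=\left\{\left(\tfrac{1-\lambda}{d(1+\lambda)},\dots,\tfrac{1-\lambda}{d(1+\lambda)}\right)\right\};$$ and when $d\ge2$ and $\lambda=0$, $$\mathcal{D}_{\Lambda^*}(0):=\{x\in\mathbb{R}^d:\Lambda^*(x)<\infty\}=\left\{x\in\mathbb{R}_+^d:\ \sum_{i=1}^dx_i=1\right\},\qquad \{x\in\mathbb{R}^d:\Lambda^*(x)=0\}=\left\{\left(\tfrac1d,\dots,\tfrac1d\right)\right\}.$$ (ii) In particular, when $d=1$ and $\lambda\in(0,1)$, $$\Lambda^*(x)=\frac x2\ln\lambda-\ln\rho_\lambda+(1+x)\ln\sqrt{1+x}+(1-x)\ln\sqrt{1-x}\quad\text{for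 }x\in[0,1],$$ and $\Lambda^*(x)=+\infty$ otherwise. When $d=2$ and $\lambda\in(0,1)$, $$\Lambda^*(x)=\frac12(x_1+x_2)\ln\lambda-\ln\rho_\lambda+\overline{\Lambda^*}(x)\quad\text{for }x=(x_1,x_2)\in\mathcal{D}_{\Lambda^*},$$ and $\Lambda^*(x)=+\infty$ otherwise, where for $x=(x_1,x_2)\in\mathbb{R}_+^2$ with $x_1+x_2\le1$, with $D(x)=\sqrt{(x_1^2-x_2^2)^2+1-2(x_1^2+x_2^2)}$, $$\overline{\Lambda^*}(x)=x_1\ln\left[\frac{2x_1+x_1^2-x_2^2+1}{D(x)}\right]+x_2\ln\left[\frac{2x_2+x_2^2-x_1^2+1}{D(x)}\right]-\ln\left[\frac{(x_1^2-x_2^2+1)+(x_2^2-x_1^2+1)}{D(x)}\right]+\ln2$$ (the right-hand side being understood by continuous extension on $x_1+x_2=1$, where $D(x)=0$). When $d\ge2$ and $\lambda=0$, $$\Lambda^*(x)=\ln d+\sum_{i=1}^dx_i\ln x_i\quad\text{for }x\in\mathcal{D}_{\Lambda^*}(0),$$ and $\Lambda^*(x)=+\infty$ otherwise.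
   Context: For $x\in\mathbb{Z}^d$ let $|x|=\sum_{i=1}^d|x_i|$, $\mathbf{0}=(0,\dots,0)$. The biased random walk $\mathrm{RW}_\lambda$ on $\mathbb{Z}^d$ is the nearest-neighbour Markov chain $(X_n)_{n\ge0}$ with the following transition probabilities $p(v,u)$ for $u$ a nearest neighbour of $v$ (and $p(v,u)=0$ otherwise): $p(\mathbf{0},u)=\frac1{2d}$; and for $v\neq\mathbf{0}$, $p(v,u)=\frac{\lambda}{2d+(\lambda-1)d_v^-}$ if $|u|=|v|-1$, and $p(v,u)=\frac{1}{2d+(\lambda-1)d_v^-}$ if $|u|=|v|+1$. Here $d_v^-$ is the number of neighbours $u$ of $v$ with $|u|=|v|-1$, i.e. $d_v^-=d-\#\{i: v_i=0\}$. $\mathbb{R}_+=[0,\infty)$, $(s,x)=\sum_i s_ix_i$, $\rho_\lambda=\frac{2\sqrt\lambda}{1+\lambda}$, $s_0=\frac12\ln\lambda$ (with $s_0=-\infty$ if $\lambda=0$), and for $s\in\mathbb{R}^d$ $$\psi(s)=N(s)\frac{\rho_\lambda}{d}+\frac1{d(1+\lambda)}\sum_{i=1}^d\{\lambda e^{-s_i}+e^{s_i}\}I_{\{s_i\ge s_0\}},\qquad N(s)=\sum_{i=1}^dI_{\{s_i<s_0\}}.$$ The convention $0\ln 0=0$ is used. A rate function is good if its sublevel sets are compact; the LDP with speed $n$ and rate function $\Lambda^*$ means $\limsup_n\frac1n\ln\mu_n(F)\le-\inf_F\Lambda^*$ for closed $F\subseteq\mathbb{R}^d$ and $\liminf_n\frac1n\ln\mu_n(G)\ge-\inf_G\Lambda^*$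 for open $G\subseteq\mathbb{R}^d$, where $\mu_n$ is the law of the $n$-th random vector. *)

theory Defs
  imports "HOL-Probability.Probability"
begin

definition ext_ln :: "real \<Rightarrow> ereal" where
  "ext_ln p = (if p = 0 then -\<infinity> else ereal (ln p))"

definition good_rate_function :: "('a::topological_space \<Rightarrow> ereal) \<Rightarrow> bool" where
  "good_rate_function I \<longleftrightarrow> (\<forall>x. 0 \<le> I x) \<and> (\<forall>a::real. compact {x. I x \<le> ereal a})"

definition satisfies_LDP ::
  "(nat \<Rightarrow> 'a::topological_space measure) \<Rightarrow> ('a \<Rightarrow> ereal) \<Rightarrow> bool" where
  "satisfies_LDP \<mu> I \<longleftrightarrow>
     (\<forall>F. closed F \<longrightarrow>
        limsup (\<lambda>n. ereal (1 / real n) * ext_ln (measure (\<mu> n) F)) \<le> - (INF x\<in>F. I x)) \<and>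
     (\<forall>G. open G \<longrightarrow>
        liminf (\<lambda>n. ereal (1 / real n) * ext_ln (measure (\<mu> n) G)) \<ge> - (INF x\<in>G. I x))"

text \<open>The lattice is \<open>int ^ 'n\<close>, so that the dimension \<open>d\<close> is \<open>CARD('n)\<close>.\<close>

definition l1 :: "int ^ 'n::finite \<Rightarrow> int" where
  "l1 v = (\<Sum>i\<in>UNIV. \<bar>v $ i\<bar>)"

definition nbr :: "int ^ 'n::finite \<Rightarrow> int ^ 'n \<Rightarrow> bool" where
  "nbr v u \<longleftrightarrow> l1 (u - v) = 1"

definition dminus :: "int ^ 'n::finite \<Rightarrow> nat" where
  "dminus v = card {u. nbr v u \<and> l1 u = l1 v - 1}"

text \<open>For neighbours, \<open>l1 u\<close> and \<open>l1 v\<close> differ by exactly one, so the last branch is never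
  reached.\<close>

definition rw_prob :: "real \<Rightarrow> int ^ 'n::finite \<Rightarrow> int ^ 'n \<Rightarrow> real" where
  "rw_prob lam v u =
     (if \<not> nbr v u then 0
      else if v = 0 then 1 / (2 * real CARD('n))
      else if l1 u = l1 v - 1 then lam / (2 * real CARD('n) + (lam - 1) * real (dminus v))
      else if l1 u = l1 v + 1 then 1 / (2 * real CARD('n) + (lam - 1) * real (dminus v))
      else 0)"

definition biased_rw ::
  "real \<Rightarrow> int ^ 'n::finite \<Rightarrow> 'a measure \<Rightarrow> (nat \<Rightarrow> 'a \<Rightarrow> int ^ 'n) \<Rightarrow> bool" where
  "biased_rw lam z M X \<longleftrightarrow>
     prob_space M \<and>
     (\<forall>n. X n \<in> measurable M (count_space UNIV)) \<and>
     (AE \<omega> in M. X 0 \<omega> = z) \<and>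
     (\<forall>n x u. \<P>(\<omega> in M. \<forall>k\<le>n. X k \<omega> = x k) > 0 \<longrightarrow>
        \<P>(\<omega> in M. X (Suc n) \<omega> = u \<bar> \<forall>k\<le>n. X k \<omega> = x k) = rw_prob lam (x n) u)"

definition scaled_abs :: "nat \<Rightarrow> int ^ 'n::finite \<Rightarrow> real ^ 'n" where
  "scaled_abs n v = (\<chi> i. real_of_int \<bar>v $ i\<bar> / real n)"

definition rho :: "real \<Rightarrow> real" where
  "rho lam = 2 * sqrt lam / (1 + lam)"

text \<open>The case distinction is needed because \<open>ln 0 = 0\<close> in HOL.\<close>

definition s0 :: "real \<Rightarrow> ereal" where
  "s0 lam = (if lam = 0 then -\<infinity> else ereal (ln lam / 2))"

definition N_below :: "real \<Rightarrow> real ^ 'n::finite \<Rightarrow> nat" where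
  "N_below lam s = (\<Sum>i\<in>UNIV. of_bool (ereal (s $ i) < s0 lam))"

definition psi :: "real \<Rightarrow> real ^ 'n::finite \<Rightarrow> real" where
  "psi lam s =
     real (N_below lam s) * (rho lam / real CARD('n)) +
     1 / (real CARD('n) * (1 + lam)) *
       (\<Sum>i\<in>UNIV. (lam * exp (- (s $ i)) + exp (s $ i)) * of_bool (ereal (s $ i) \<ge> s0 lam))"

definition Lambda_star :: "real \<Rightarrow> real ^ 'n::finite \<Rightarrow> ereal" where
  "Lambda_star lam x = (SUP s. ereal (s \<bullet> x - ln (psi lam s)))"

definition D_Lambda_star :: "real \<Rightarrow> (real ^ 'n::finite) set" where
  "D_Lambda_star lam = {x. Lambda_star lam x < \<infinity>}"

definition D_fun :: "real \<Rightarrow> real \<Rightarrow> real" where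
  "D_fun a b = sqrt ((a\<^sup>2 - b\<^sup>2)\<^sup>2 + 1 - 2 * (a\<^sup>2 + b\<^sup>2))"

definition Lambda_bar_formula :: "real \<Rightarrow> real \<Rightarrow> real" where
  "Lambda_bar_formula a b =
     a * ln ((2 * a + a\<^sup>2 - b\<^sup>2 + 1) / D_fun a b) +
     b * ln ((2 * b + b\<^sup>2 - a\<^sup>2 + 1) / D_fun a b) -
     ln (((a\<^sup>2 - b\<^sup>2 + 1) + (b\<^sup>2 - a\<^sup>2 + 1)) / D_fun a b) + ln 2"

definition unit_triangle :: "(real \<times> real) set" where
  "unit_triangle = {(a, b). 0 \<le> a \<and> 0 \<le> b \<and> a + b \<le> 1}"

text \<open>On \<open>a + b = 1\<close> one has \<open>D_fun a b = 0\<close>, and the value is the limit of the formula from the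
  rest of the triangle. That this limit exists is part of a claim of continuity of
  \<open>Lambda_bar\<close> on \<open>unit_triangle\<close>, not of this definition.\<close>

definition Lambda_bar :: "real \<times> real \<Rightarrow> real" where
  "Lambda_bar p =
     (if fst p + snd p < 1 then Lambda_bar_formula (fst p) (snd p)
      else Lim (at p within {q \<in> unit_triangle. fst q + snd q < 1})
             (\<lambda>q. Lambda_bar_formula (fst q) (snd q)))"

end

theory Submission
  imports Defs
begin

text \<open>
  The transition probabilities see a lattice point only through the absolute values of its
  coordinates: from a family \<open>w\<close> of such values the folded walk raises a nonzero coordinate with
  weight \<open>1\<close>, lowers it with weight \<open>lam\<close>, leaves \<open>0\<close> with weight \<open>2\<close>, and all weights are divided
  by \<open>total_rate lam w\<close>. This denominator is at least \<open>d * (1 + lam)\<close>, with equality exactly where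
  no coordinate vanishes. So the coordinate hyperplanes only make the walk lose mass compared with
  the homogeneous weights, and away from them the two agree. Both halves of the large deviation
  principle exploit this.

  Upper bound. With the denominator replaced by \<open>d * (1 + lam)\<close>, the one-step operator is a sum of
  one-dimensional operators, and \<open>exp (a * x) + lam ^ x * exp (- a * x)\<close> is an eigenfunction of each
  one, with eigenvalue \<open>lam * exp (- a) + exp a\<close>, reflection at \<open>0\<close> included. This eigenfunction
  dominates \<open>exp (s * x)\<close> whenever \<open>a \<ge> s\<close>. For positive \<open>lam\<close> the eigenvalue is smallest at
  \<open>a = ln lam / 2\<close>, which is \<open>s0\<close>; taking the best \<open>a\<close> for every coordinate gives
  precisely the truncated function \<open>psi\<close> (\<open>folded_step_potential\<close>). Hence the exponential moments are at most a constant times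
  \<open>psi lam s ^ n\<close>, and a covering of closed sets by half spaces finishes the upper bound
  (\<open>limsup_closed_le\<close>).

  Lower bound. For \<open>s\<close> above the truncation level, weighting the steps by \<open>exp (s \<bullet> step)\<close> turns the
  homogeneous weights into a walk with drift equal to the gradient \<open>x\<close> of \<open>ln psi\<close> at \<open>s\<close>. If this
  drift is positive in every coordinate, a walk that starts far from the hyperplanes stays away from
  them and near its mean with a probability bounded below. Instead of building the tilted walk,
  \<open>folded_iterate_lower\<close> compares iterates of the folded operator with an explicit subsolution that
  is nonpositive on the hyperplanes and, at the final time, outside the target box. This gives the rate
  \<open>s \<bullet> x - ln (psi lam s)\<close>, which is at most \<open>Lambda_star lam x\<close> by the definition of the supremum.
  Every \<open>x\<close> with positive coordinates, of sum below \<open>1\<close> (equal to \<open>1\<close> when \<open>lam = 0\<close>), is such a drift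
  (\<open>tilt_exists\<close>): the defining supremum is attained there. All other points of the domain are
  reached by moving them slightly towards the zero of \<open>Lambda_star\<close>, which by convexity does not
  increase the rate.

  Closed forms. The substitution \<open>s = s0 + t\<close> turns \<open>psi\<close> into \<open>rho\<close> times the mean of
  \<open>cosh (max t 0)\<close>, so that on the positive orthant \<open>Lambda_star\<close> is a linear term plus the rate
  function of the symmetric walk. In dimension one this is, up to sign and an additive constant, the
  entropy of a biased coin with mean \<open>x\<close>; in dimension two,
  \<open>cosh (u + v) + cosh (u - v) = 2 * cosh u * cosh v\<close> splits it into two coins with means \<open>x1 + x2\<close> and \<open>x1 - x2\<close>. For \<open>lam = 0\<close> the function \<open>psi\<close> is a mean of exponentials, whose conjugate
  is the relative entropy by the variational principle of Gibbs.
\<close>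

section \<open>Nearest neighbours in the lattice\<close>

lemma axis_component: "axis i a $ j = (if j = i then a else 0)"
  by (simp add: axis_def)

lemma l1_shift:
  fixes v :: "int ^ 'n::finite"
  shows "l1 (v + axis i a) = l1 v - \<bar>v $ i\<bar> + \<bar>v $ i + a\<bar>"
proof -
  have 1: "l1 u = \<bar>u $ i\<bar> + (\<Sum>j\<in>UNIV - {i}. \<bar>u $ j\<bar>)" for u :: "int ^ 'n"
    unfolding l1_def by (rule sum.remove) auto
  have 2: "(\<Sum>j\<in>UNIV - {i}. \<bar>(v + axis i a) $ j\<bar>) = (\<Sum>j\<in>UNIV - {i}. \<bar>v $ j\<bar>)"
    by (rule sum.cong) (auto simp: axis_component)
  show ?thesis
    unfolding 1[of v] 1[of "v + axis i a"] 2 by (simp add: axis_component)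
qed

lemma l1_eq_one_iff: "l1 w = 1 \<longleftrightarrow> (\<exists>i. w = axis i 1 \<or> w = axis i (- 1))"
proof
  assume w: "l1 w = 1"
  then obtain i where i: "w $ i \<noteq> 0"
    unfolding l1_def by (metis abs_zero sum.neutral zero_neq_one)
  have "\<bar>w $ i\<bar> + (\<Sum>j\<in>UNIV - {i}. \<bar>w $ j\<bar>) = 1"
    using w unfolding l1_def by (subst (asm) sum.remove[of _ i]) auto
  moreover have "(\<Sum>j\<in>UNIV - {i}. \<bar>w $ j\<bar>) \<ge> 0" by (simp add: sum_nonneg)
  ultimately have a: "\<bar>w $ i\<bar> = 1" and b: "(\<Sum>j\<in>UNIV - {i}. \<bar>w $ j\<bar>) = 0"
    using i by linarith+
  from b have "\<forall>j\<in>UNIV - {i}. \<bar>w $ j\<bar> = 0" by (subst (asm) sum_nonneg_eq_0_iff) auto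
  then have "w = axis i (w $ i)" by (auto simp: vec_eq_iff axis_component)
  moreover have "w $ i = 1 \<or> w $ i = - 1" using a by linarith
  ultimately show "\<exists>i. w = axis i 1 \<or> w = axis i (- 1)" by metis
next
  assume "\<exists>i. w = axis i 1 \<or> w = axis i (- 1)"
  moreover have "l1 (axis i a) = \<bar>a\<bar>" for i :: 'a and a
    using l1_shift[of 0 i a] by (simp add: l1_def)
  ultimately show "l1 w = 1" by auto
qed

lemma nbr_set: "{u. nbr v u} = (\<lambda>(i, a). v + axis i a) ` (UNIV \<times> {1, - 1})"
  unfolding nbr_def l1_eq_one_iff
  by (auto simp: image_iff algebra_simps diff_eq_eq eq_diff_eq)

lemma inj_nbr: "inj_on (\<lambda>(i, a). v + axis i a) (UNIV \<times> {1, - 1 :: int})"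
proof (rule inj_onI, clarify)
  fix i j :: 'a and a b :: int
  assume ab: "a \<in> {1, - 1}" "b \<in> {1, - 1}" and eq: "v + axis i a = v + axis j b"
  then have "axis i a $ i = axis j b $ i" by simp
  then show "i = j \<and> a = b" using ab by (auto simp: axis_component split: if_splits)
qed

lemma finite_nbr: "finite {u. nbr v u}"
  unfolding nbr_set by simp

lemma sum_nbr:
  "(\<Sum>u | nbr v u. g u) = (\<Sum>i\<in>UNIV. g (v + axis i 1) + g (v + axis i (- 1)))"
proof -
  have "(\<Sum>u | nbr v u. g u) = (\<Sum>p\<in>UNIV \<times> {1, - 1}. g (case p of (i, a) \<Rightarrow> v + axis i a))"
    unfolding nbr_set by (subst sum.reindex[OF inj_nbr]) simp
  also have "\<dots> = (\<Sum>i\<in>UNIV. \<Sum>a\<in>{1, - 1}. g (v + axis i a))"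
    by (subst sum.cartesian_product) (rule sum.cong, auto)
  finally show ?thesis by simp
qed

text \<open>Every nonzero coordinate has exactly one neighbour with smaller absolute value, obtained by
  subtracting its sign.\<close>

lemma dminus_eq: "dminus v = card {i. v $ i \<noteq> 0}"
proof -
  have "bij_betw (\<lambda>i. v + axis i (- sgn (v $ i))) {i. v $ i \<noteq> 0} {u. nbr v u \<and> l1 u = l1 v - 1}"
  proof (rule bij_betw_imageI)
    show "inj_on (\<lambda>i. v + axis i (- sgn (v $ i))) {i. v $ i \<noteq> 0}"
    proof (rule inj_onI)
      fix i j assume ij: "i \<in> {i. v $ i \<noteq> 0}" "j \<in> {i. v $ i \<noteq> 0}"
        and "v + axis i (- sgn (v $ i)) = v + axis j (- sgn (v $ j))"
      then have "axis i (- sgn (v $ i)) $ i = axis j (- sgn (v $ j)) $ i" by simp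
      then show "i = j" using ij by (auto simp: axis_component sgn_if split: if_splits)
    qed
    have "u \<in> (\<lambda>i. v + axis i (- sgn (v $ i))) ` {i. v $ i \<noteq> 0}"
      if u: "nbr v u" "l1 u = l1 v - 1" for u
    proof -
      have "u \<in> {u. nbr v u}" using u by simp
      then obtain i a where ia: "u = v + axis i a" "a = 1 \<or> a = - 1"
        unfolding nbr_set by auto
      with u(2) have "\<bar>v $ i + a\<bar> = \<bar>v $ i\<bar> - 1" by (simp add: l1_shift)
      then have "v $ i \<noteq> 0" "a = - sgn (v $ i)" using ia(2) by (auto simp: sgn_if)
      then show ?thesis using ia by auto
    qed
    moreover have "nbr v (v + axis i (- sgn (v $ i))) \<and> l1 (v + axis i (- sgn (v $ i))) = l1 v - 1"
      if "v $ i \<noteq> 0" for i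
      using that by (auto simp: nbr_def l1_eq_one_iff l1_shift sgn_if)
    ultimately show "(\<lambda>i. v + axis i (- sgn (v $ i))) ` {i. v $ i \<noteq> 0}
        = {u. nbr v u \<and> l1 u = l1 v - 1}"
      by blast
  qed
  then show ?thesis unfolding dminus_def by (simp add: bij_betw_same_card)
qed

section \<open>The walk of absolute values\<close>

definition total_rate :: "real \<Rightarrow> ('n::finite \<Rightarrow> nat) \<Rightarrow> real" where
  "total_rate lam w = 2 * real CARD('n) - (1 - lam) * real (card {i. w i \<noteq> 0})"

definition abs_coords :: "int ^ 'n::finite \<Rightarrow> 'n \<Rightarrow> nat" where
  "abs_coords v = (\<lambda>i. nat \<bar>v $ i\<bar>)"

text \<open>The one-step operator acts on functions of the absolute values. A coordinate equal to \<open>0\<close> has two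
  upward neighbours, whence the factor \<open>2\<close>.\<close>

definition folded_step :: "real \<Rightarrow> (('n::finite \<Rightarrow> nat) \<Rightarrow> real) \<Rightarrow> ('n \<Rightarrow> nat) \<Rightarrow> real" where
  "folded_step lam F w =
     (\<Sum>i\<in>UNIV. if w i = 0 then 2 * F (w(i := 1))
        else F (w(i := Suc (w i))) + lam * F (w(i := w i - 1))) / total_rate lam w"

lemma rw_prob_shift:
  assumes "a = 1 \<or> a = - 1"
  shows "rw_prob lam v (v + axis i a)
    = (if \<bar>v $ i + a\<bar> < \<bar>v $ i\<bar> then lam else 1) / total_rate lam (abs_coords v)"
proof -
  have n: "nbr v (v + axis i a)" using assms by (auto simp: nbr_def l1_eq_one_iff)
  have d: "total_rate lam (abs_coords v) = 2 * real CARD('a) + (lam - 1) * real (dminus v)"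
    unfolding total_rate_def abs_coords_def dminus_eq by (simp add: algebra_simps)
  have "\<bar>v $ i + a\<bar> = \<bar>v $ i\<bar> - 1 \<or> \<bar>v $ i + a\<bar> = \<bar>v $ i\<bar> + 1" using assms by auto
  moreover have "total_rate lam (abs_coords v) = 2 * real CARD('a)" "v $ i = 0" if "v = 0"
    using that by (simp_all add: total_rate_def abs_coords_def)
  ultimately show ?thesis
    using n by (auto simp: rw_prob_def l1_shift d[symmetric])
qed

lemma abs_coords_shift: "abs_coords (v + axis i a) = (abs_coords v)(i := nat \<bar>v $ i + a\<bar>)"
  by (auto simp: abs_coords_def axis_component fun_eq_iff)

lemma sum_rw_prob_folded:
  "(\<Sum>u | nbr v u. rw_prob lam v u * F (abs_coords u)) = folded_step lam F (abs_coords v)"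
proof -
  let ?w = "abs_coords v"
  have "rw_prob lam v (v + axis i 1) * F (abs_coords (v + axis i 1))
      + rw_prob lam v (v + axis i (- 1)) * F (abs_coords (v + axis i (- 1)))
    = (if ?w i = 0 then 2 * F (?w(i := 1))
        else F (?w(i := Suc (?w i))) + lam * F (?w(i := ?w i - 1))) / total_rate lam ?w" for i
  proof -
    consider "v $ i = 0" | "v $ i > 0" | "v $ i < 0" by linarith
    then show ?thesis
    proof cases
      case 1
      then show ?thesis
        by (simp add: rw_prob_shift abs_coords_shift) (simp add: abs_coords_def)
    next
      case 2
      then have "?w i \<noteq> 0" "nat \<bar>v $ i + 1\<bar> = Suc (?w i)" "nat \<bar>v $ i - 1\<bar> = ?w i - 1"
          "\<not> \<bar>v $ i + 1\<bar> < \<bar>v $ i\<bar>" "\<bar>v $ i - 1\<bar> < \<bar>v $ i\<bar>"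
        by (auto simp: abs_coords_def)
      then show ?thesis
        by (simp add: rw_prob_shift abs_coords_shift add_divide_distrib)
    next
      case 3
      then have "?w i \<noteq> 0" "nat \<bar>v $ i - 1\<bar> = Suc (?w i)" "nat \<bar>v $ i + 1\<bar> = ?w i - 1"
          "\<not> \<bar>v $ i - 1\<bar> < \<bar>v $ i\<bar>" "\<bar>v $ i + 1\<bar> < \<bar>v $ i\<bar>"
        by (auto simp: abs_coords_def)
      then show ?thesis
        by (simp add: rw_prob_shift abs_coords_shift add_divide_distrib)
    qed
  qed
  then show ?thesis
    unfolding sum_nbr folded_step_def sum_divide_distrib by (intro sum.cong) auto
qed

text \<open>This comparison is the source of the upper bound: on a coordinate hyperplane every transition has
  at most the probability that the homogeneous weights would give it.\<close>

lemma total_rate_ge: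
  assumes "lam \<le> 1"
  shows "real CARD('n::finite) * (1 + lam) \<le> total_rate lam (w :: 'n \<Rightarrow> nat)"
proof -
  have "real (card {i. w i \<noteq> 0}) \<le> real CARD('n)" by (simp add: card_mono)
  then have "(1 - lam) * real (card {i. w i \<noteq> 0}) \<le> (1 - lam) * real CARD('n)"
    using assms by (intro mult_left_mono) auto
  then show ?thesis by (simp add: total_rate_def algebra_simps)
qed

lemma total_rate_pos:
  assumes "0 \<le> lam" "lam < 1"
  shows "0 < total_rate lam (w :: 'n::finite \<Rightarrow> nat)"
  using total_rate_ge[of lam w] assms
  by (smt (verit, best) mult_pos_pos of_nat_0_less_iff zero_less_card_finite)

lemma total_rate_interior:
  assumes "\<And>i. w i \<noteq> 0"
  shows "total_rate lam (w :: 'n::finite \<Rightarrow> nat) = real CARD('n) * (1 + lam)"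
  using assms by (simp add: total_rate_def algebra_simps)

lemma folded_step_mono:
  assumes "0 \<le> lam" "lam < 1" "\<And>w. F w \<le> G w"
  shows "folded_step lam F w \<le> folded_step lam G w"
  unfolding folded_step_def using total_rate_pos[OF assms(1,2), of w] assms
  by (intro divide_right_mono sum_mono) (auto intro!: add_mono mult_left_mono)

lemma folded_step_nonneg:
  assumes "0 \<le> lam" "lam < 1" "\<And>w. 0 \<le> F w"
  shows "0 \<le> folded_step lam F w"
  using folded_step_mono[OF assms(1,2), of "\<lambda>_. 0" F w] assms(3)
  by (simp add: folded_step_def cong: if_cong)

section \<open>The Markov property\<close>

lemma nn_integral_countable_valued:
  fixes Y :: "'a \<Rightarrow> 'b::countable"
  assumes Y: "Y \<in> measurable M (count_space UNIV)"
  shows "(\<integral>\<^sup>+\<omega>. g (Y \<omega>) \<partial>M) = (\<integral>\<^sup>+y. emeasure M {\<omega> \<in> space M. Y \<omega> = y} * g y \<partial>count_space UNIV)"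
proof -
  have "distr M (count_space UNIV) Y
      = density (count_space UNIV) (\<lambda>y. emeasure M {\<omega> \<in> space M. Y \<omega> = y})"
  proof (rule measure_eqI_countable[where A=UNIV])
    fix y
    have "Y -` {y} \<inter> space M = {\<omega> \<in> space M. Y \<omega> = y}" by auto
    then show "emeasure (distr M (count_space UNIV) Y) {y}
        = emeasure (density (count_space UNIV) (\<lambda>y. emeasure M {\<omega> \<in> space M. Y \<omega> = y})) {y}"
      using Y by (simp add: emeasure_distr emeasure_density nn_integral_count_space_indicator[symmetric]
          nn_integral_indicator_singleton)
  qed auto
  then have "(\<integral>\<^sup>+y. g y \<partial>distr M (count_space UNIV) Y)
      = (\<integral>\<^sup>+y. g y \<partial>density (count_space UNIV) (\<lambda>y. emeasure M {\<omega> \<in> space M. Y \<omega> = y}))"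
    by simp
  then show ?thesis
    using Y by (simp add: nn_integral_distr nn_integral_density)
qed

lemma rw_prob_nonneg:
  assumes "0 \<le> lam" "lam < 1"
  shows "0 \<le> rw_prob lam (v :: int ^ 'n::finite) u"
proof (cases "nbr v u")
  case True
  then have "u \<in> {u. nbr v u}" by simp
  then obtain i a where u: "u = v + axis i a" "a = 1 \<or> a = - 1"
    unfolding nbr_set by auto
  show ?thesis
    unfolding u(1) rw_prob_shift[OF u(2)] using assms total_rate_pos[OF assms, of "abs_coords v"]
    by auto
qed (simp add: rw_prob_def)

text \<open>The defining conditional probabilities refer to complete histories. The list of the first \<open>n + 1\<close>
  positions takes countably many values, so summing over it reduces the claim to one conditional law,
  which depends on the last entry only.\<close>

lemma biased_rw_one_step:
  fixes X :: "nat \<Rightarrow> 'a \<Rightarrow> int ^ 'n::finite"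
  assumes rw: "biased_rw lam z M X" and lam: "0 \<le> lam" "lam < 1" and F: "\<And>w. 0 \<le> F w"
  shows "(\<integral>\<^sup>+\<omega>. ennreal (F (abs_coords (X (Suc n) \<omega>))) \<partial>M)
    = (\<integral>\<^sup>+\<omega>. ennreal (folded_step lam F (abs_coords (X n \<omega>))) \<partial>M)"
proof -
  interpret prob_space M using rw by (simp add: biased_rw_def)
  have X[measurable]: "X k \<in> measurable M (count_space UNIV)" for k
    using rw by (simp add: biased_rw_def)
  have cond: "\<P>(\<omega> in M. X (Suc n) \<omega> = u \<bar> \<forall>k\<le>n. X k \<omega> = x k) = rw_prob lam (x n) u"
    if "\<P>(\<omega> in M. \<forall>k\<le>n. X k \<omega> = x k) > 0" for x u
    using rw that by (simp add: biased_rw_def)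
  define H where "H \<omega> = map (\<lambda>k. X k \<omega>) [0..<Suc n]" for \<omega>
  have H_eq: "{\<omega> \<in> space M. H \<omega> = h}
      = (if length h = Suc n then {\<omega> \<in> space M. \<forall>k\<le>n. X k \<omega> = h ! k} else {})" for h
    unfolding H_def by (auto simp: list_eq_iff_nth_eq less_Suc_eq_le simp del: upt_Suc)
  have hist_sets: "{\<omega> \<in> space M. \<forall>k\<le>n. X k \<omega> = x k} \<in> sets M" for x
    by measurable
  have H[measurable]: "H \<in> measurable M (count_space UNIV)"
    by (subst measurable_count_space_eq2_countable)
      (use H_eq hist_sets in \<open>auto simp: vimage_def Int_def conj_commute\<close>)
  have joint: "emeasure M {\<omega> \<in> space M. H \<omega> = h \<and> X (Suc n) \<omega> = u}
      = emeasure M {\<omega> \<in> space M. H \<omega> = h} * ennreal (rw_prob lam (h ! n) u)" for h u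
  proof (cases "length h = Suc n")
    case True
    let ?A = "{\<omega> \<in> space M. \<forall>k\<le>n. X k \<omega> = h ! k}"
    have A: "{\<omega> \<in> space M. H \<omega> = h} = ?A" using True by (simp add: H_eq)
    have B: "{\<omega> \<in> space M. H \<omega> = h \<and> X (Suc n) \<omega> = u}
        = {\<omega> \<in> space M. X (Suc n) \<omega> = u \<and> (\<forall>k\<le>n. X k \<omega> = h ! k)}"
      using A by blast
    have sub: "{\<omega> \<in> space M. X (Suc n) \<omega> = u \<and> (\<forall>k\<le>n. X k \<omega> = h ! k)} \<subseteq> ?A" by auto
    have "measure M {\<omega> \<in> space M. X (Suc n) \<omega> = u \<and> (\<forall>k\<le>n. X k \<omega> = h ! k)}
        = measure M ?A * rw_prob lam (h ! n) u"
    proof (cases "measure M ?A > 0")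
      case True
      then show ?thesis
        using cond[OF True, of u] by (simp add: cond_prob_def field_simps)
    next
      case False
      then have "measure M ?A = 0" by (simp add: zero_less_measure_iff)
      moreover have "measure M {\<omega> \<in> space M. X (Suc n) \<omega> = u \<and> (\<forall>k\<le>n. X k \<omega> = h ! k)}
          \<le> measure M ?A"
        by (rule finite_measure_mono[OF sub hist_sets])
      ultimately show ?thesis
        by (simp add: measure_le_0_iff)
    qed
    then show ?thesis
      unfolding A B using rw_prob_nonneg[OF lam] by (simp add: emeasure_eq_measure ennreal_mult')
  next
    case False
    then have "{\<omega> \<in> space M. H \<omega> = h} = {}" by (simp add: H_eq)
    moreover from this have "{\<omega> \<in> space M. H \<omega> = h \<and> X (Suc n) \<omega> = u} = {}"
      by blast
    ultimately show ?thesis by (simp only: emeasure_empty mult_zero_left)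
  qed
  have inner: "(\<integral>\<^sup>+u. ennreal (rw_prob lam v u) * ennreal (F (abs_coords u)) \<partial>count_space UNIV)
      = ennreal (folded_step lam F (abs_coords v))" for v :: "int ^ 'n"
  proof -
    have "(\<integral>\<^sup>+u. ennreal (rw_prob lam v u) * ennreal (F (abs_coords u)) \<partial>count_space UNIV)
        = (\<Sum>u | nbr v u. ennreal (rw_prob lam v u) * ennreal (F (abs_coords u)))"
      by (rule nn_integral_count_space'[OF finite_nbr]) (auto simp: rw_prob_def)
    also have "\<dots> = (\<Sum>u | nbr v u. ennreal (rw_prob lam v u * F (abs_coords u)))"
      by (intro sum.cong refl) (simp add: ennreal_mult rw_prob_nonneg[OF lam] F)
    also have "\<dots> = ennreal (\<Sum>u | nbr v u. rw_prob lam v u * F (abs_coords u))"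
      by (intro sum_ennreal mult_nonneg_nonneg rw_prob_nonneg lam F)
    finally show ?thesis unfolding sum_rw_prob_folded .
  qed
  have "(\<integral>\<^sup>+\<omega>. ennreal (F (abs_coords (X (Suc n) \<omega>))) \<partial>M)
      = (\<integral>\<^sup>+\<omega>. (\<lambda>(h, u). ennreal (F (abs_coords u))) (H \<omega>, X (Suc n) \<omega>) \<partial>M)"
    by simp
  also have "\<dots> = (\<integral>\<^sup>+p. emeasure M {\<omega> \<in> space M. (H \<omega>, X (Suc n) \<omega>) = p} *
      (\<lambda>(h, u). ennreal (F (abs_coords u))) p \<partial>count_space UNIV)"
  proof (rule nn_integral_countable_valued)
    have *: "{\<omega> \<in> space M. H \<omega> = h \<and> X (Suc n) \<omega> = u} \<in> sets M" for h u
      by measurable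
    show "(\<lambda>\<omega>. (H \<omega>, X (Suc n) \<omega>)) \<in> measurable M (count_space UNIV)"
      by (subst measurable_count_space_eq2_countable)
        (use * in \<open>auto simp: vimage_def Int_def conj_ac\<close>)
  qed
  also have "\<dots> = (\<integral>\<^sup>+h. (\<integral>\<^sup>+u. emeasure M {\<omega> \<in> space M. (H \<omega>, X (Suc n) \<omega>) = (h, u)} *
      ennreal (F (abs_coords u)) \<partial>count_space UNIV) \<partial>count_space UNIV)"
    by (subst nn_integral_fst_count_space[symmetric]) simp
  also have "\<dots> = (\<integral>\<^sup>+h. emeasure M {\<omega> \<in> space M. H \<omega> = h} *
      (\<integral>\<^sup>+u. ennreal (rw_prob lam (h ! n) u) * ennreal (F (abs_coords u)) \<partial>count_space UNIV) \<partial>count_space UNIV)"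
    by (simp add: joint mult.assoc nn_integral_cmult)
  also have "\<dots> = (\<integral>\<^sup>+\<omega>. ennreal (folded_step lam F (abs_coords (H \<omega> ! n))) \<partial>M)"
    unfolding inner by (rule nn_integral_countable_valued[OF H, symmetric])
  also have "\<dots> = (\<integral>\<^sup>+\<omega>. ennreal (folded_step lam F (abs_coords (X n \<omega>))) \<partial>M)"
    unfolding H_def by (simp del: upt_Suc)
  finally show ?thesis .
qed

text \<open>The one-step identity for expectations of nonnegative functions is the only form in which the
  Markov property enters below.\<close>

locale folded_walk = prob_space M for M :: "'a measure" +
  fixes lam :: real and W :: "nat \<Rightarrow> 'a \<Rightarrow> 'n::finite \<Rightarrow> nat" and w0 :: "'n \<Rightarrow> nat"
  assumes lam: "0 \<le> lam" "lam < 1"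
    and W_measurable [measurable]: "W n \<in> measurable M (count_space UNIV)"
    and W_start: "AE \<omega> in M. W 0 \<omega> = w0"
    and W_step: "(\<And>w. 0 \<le> F w) \<Longrightarrow> (\<integral>\<^sup>+\<omega>. ennreal (F (W (Suc n) \<omega>)) \<partial>M)
      = (\<integral>\<^sup>+\<omega>. ennreal (folded_step lam F (W n \<omega>)) \<partial>M)"

lemma folded_walk_abs_coords:
  assumes rw: "biased_rw lam z M X" and lam: "0 \<le> lam" "lam < 1"
  shows "folded_walk M lam (\<lambda>n \<omega>. abs_coords (X n \<omega>)) (abs_coords z)"
proof -
  interpret prob_space M using rw by (simp add: biased_rw_def)
  have X[measurable]: "X k \<in> measurable M (count_space UNIV)" for k
    using rw by (simp add: biased_rw_def)
  show ?thesis
  proof unfold_locales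
    show "(\<lambda>\<omega>. abs_coords (X n \<omega>)) \<in> measurable M (count_space UNIV)" for n
      by measurable
    show "AE \<omega> in M. abs_coords (X 0 \<omega>) = abs_coords z"
      using rw by (auto simp: biased_rw_def)
  qed (use lam biased_rw_one_step[OF rw lam] in auto)
qed

context folded_walk
begin

text \<open>A nonnegative supersolution of \<open>folded_step\<close> with factor \<open>c\<close> is, up to \<open>c ^ n\<close>, a supermartingale.\<close>

lemma expectation_le_power:
  assumes F: "\<And>w. 0 \<le> F w" and c: "0 \<le> c" and le: "\<And>w. folded_step lam F w \<le> c * F w"
  shows "(\<integral>\<^sup>+\<omega>. ennreal (F (W n \<omega>)) \<partial>M) \<le> ennreal (c ^ n * F w0)"
proof (induction n)
  case 0
  have "(\<integral>\<^sup>+\<omega>. ennreal (F (W 0 \<omega>)) \<partial>M) = (\<integral>\<^sup>+\<omega>. ennreal (F w0) \<partial>M)"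
    by (rule nn_integral_cong_AE) (use W_start in auto)
  then show ?case by (simp add: emeasure_space_1)
next
  case (Suc n)
  have "(\<integral>\<^sup>+\<omega>. ennreal (F (W (Suc n) \<omega>)) \<partial>M) \<le> (\<integral>\<^sup>+\<omega>. ennreal c * ennreal (F (W n \<omega>)) \<partial>M)"
    unfolding W_step[where F=F, OF F] using le c F
    by (intro nn_integral_mono) (simp add: ennreal_mult[symmetric] ennreal_leI)
  also have "\<dots> = ennreal c * (\<integral>\<^sup>+\<omega>. ennreal (F (W n \<omega>)) \<partial>M)"
    by (rule nn_integral_cmult) measurable
  also have "\<dots> \<le> ennreal c * ennreal (c ^ n * F w0)"
    by (intro mult_left_mono Suc) simp
  also have "\<dots> = ennreal (c ^ Suc n * F w0)"
    using c F by (simp add: ennreal_mult[symmetric] mult.assoc)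
  finally show ?case .
qed

lemma expectation_iterate:
  assumes F: "\<And>w. 0 \<le> F w"
  shows "(\<integral>\<^sup>+\<omega>. ennreal (F (W (m + n) \<omega>)) \<partial>M)
    = (\<integral>\<^sup>+\<omega>. ennreal ((folded_step lam ^^ n) F (W m \<omega>)) \<partial>M)"
  using F
proof (induction n arbitrary: F)
  case (Suc n)
  have "(\<integral>\<^sup>+\<omega>. ennreal (F (W (m + Suc n) \<omega>)) \<partial>M)
      = (\<integral>\<^sup>+\<omega>. ennreal (folded_step lam F (W (m + n) \<omega>)) \<partial>M)"
    using W_step[OF Suc.prems] by simp
  also have "\<dots> = (\<integral>\<^sup>+\<omega>. ennreal ((folded_step lam ^^ n) (folded_step lam F) (W m \<omega>)) \<partial>M)"
    by (rule Suc.IH) (rule folded_step_nonneg[OF lam Suc.prems])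
  finally show ?case by (simp only: funpow_Suc_right o_def)
qed simp

lemma prob_iterate_ge:
  assumes c: "0 \<le> c" "c \<le> (folded_step lam ^^ n) (\<lambda>w. of_bool (w \<in> B)) y"
  shows "prob {\<omega> \<in> space M. W m \<omega> = y} * c \<le> prob {\<omega> \<in> space M. W (m + n) \<omega> \<in> B}"
proof -
  let ?b = "\<lambda>w. of_bool (w \<in> B) :: real"
  have sets: "{\<omega> \<in> space M. W m \<omega> = y} \<in> sets M" "{\<omega> \<in> space M. W (m + n) \<omega> \<in> B} \<in> sets M"
    by measurable
  have "ennreal (prob {\<omega> \<in> space M. W m \<omega> = y} * c)
      = (\<integral>\<^sup>+\<omega>. ennreal c * indicator {\<omega> \<in> space M. W m \<omega> = y} \<omega> \<partial>M)"
    using sets c by (simp add: nn_integral_cmult_indicator emeasure_eq_measure ennreal_mult' mult.commute)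
  also have "\<dots> \<le> (\<integral>\<^sup>+\<omega>. ennreal ((folded_step lam ^^ n) ?b (W m \<omega>)) \<partial>M)"
    using c by (intro nn_integral_mono) (auto simp: indicator_def intro!: ennreal_leI)
  also have "\<dots> = (\<integral>\<^sup>+\<omega>. ennreal (?b (W (m + n) \<omega>)) \<partial>M)"
    by (rule expectation_iterate[symmetric]) auto
  also have "\<dots> = (\<integral>\<^sup>+\<omega>. indicator {\<omega> \<in> space M. W (m + n) \<omega> \<in> B} \<omega> \<partial>M)"
    by (intro nn_integral_cong) (auto simp: indicator_def)
  also have "\<dots> = ennreal (prob {\<omega> \<in> space M. W (m + n) \<omega> \<in> B})"
    using sets by (simp add: emeasure_eq_measure)
  finally show ?thesis by (simp add: ennreal_le_iff)
qed

end

section \<open>Exponential moments\<close>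

text \<open>Slopes below \<open>s0\<close> are raised to \<open>s0\<close>, where the eigenvalue \<open>lam * exp (- a) + exp a\<close> is smallest.
  For \<open>lam = 0\<close> there is no truncation level, and \<open>ln 0 = 0\<close> would give a wrong one.\<close>

definition clip :: "real \<Rightarrow> real \<Rightarrow> real" where
  "clip lam a = (if lam = 0 then a else max a (ln lam / 2))"

text \<open>Up to the factor \<open>2 * lam powr (x / 2)\<close> this is \<open>cosh ((a - s0) * x)\<close>, the even eigenfunction of the
  symmetric walk on the integers; the present form also makes sense for \<open>lam = 0\<close>, where \<open>0 ^ 0 = 1\<close>
  supplies the value \<open>2\<close> at the origin.\<close>

definition radial :: "real \<Rightarrow> real \<Rightarrow> nat \<Rightarrow> real" where
  "radial lam a x = exp (a * real x) + lam ^ x * exp (- (a * real x))"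

definition potential :: "real \<Rightarrow> real ^ 'n::finite \<Rightarrow> ('n \<Rightarrow> nat) \<Rightarrow> real" where
  "potential lam s w = (\<Prod>i\<in>UNIV. radial lam (clip lam (s $ i)) (w i))"

lemma clip_nonneg:
  assumes "0 \<le> lam" "lam < 1" "0 \<le> a"
  shows "clip lam a = a"
proof (cases "lam = 0")
  case False
  then have "ln lam < 0" using assms by (intro ln_less_zero) auto
  then show ?thesis using assms by (simp add: clip_def)
qed (simp add: clip_def)

lemma rho_split:
  assumes "0 < lam"
  shows "rho lam / d = (lam * exp (- (ln lam / 2)) + exp (ln lam / 2)) / (d * (1 + lam))"
proof -
  have e: "exp (ln lam / 2) = sqrt lam"
    using assms by (simp add: ln_sqrt[symmetric])
  have "lam * exp (- (ln lam / 2)) = sqrt lam"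
    unfolding exp_minus e using assms by (simp add: field_simps)
  then show ?thesis unfolding rho_def e by simp
qed

text \<open>The two branches of \<open>psi\<close> are one formula: \<open>rho / d\<close> is the summand at the truncation level.\<close>

lemma psi_clip:
  fixes s :: "real ^ 'n::finite"
  assumes lam: "0 \<le> lam" "lam < 1"
  shows "psi lam s = (\<Sum>i\<in>UNIV. lam * exp (- clip lam (s $ i)) + exp (clip lam (s $ i)))
    / (real CARD('n) * (1 + lam))"
proof -
  let ?d = "real CARD('n) * (1 + lam)"
  have "of_bool (ereal (s $ i) < s0 lam) * (rho lam / real CARD('n))
      + (lam * exp (- (s $ i)) + exp (s $ i)) * of_bool (ereal (s $ i) \<ge> s0 lam) / ?d
    = (lam * exp (- clip lam (s $ i)) + exp (clip lam (s $ i))) / ?d" for i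
  proof (cases "lam = 0")
    case False
    then have "rho lam / real CARD('n) = (lam * exp (- (ln lam / 2)) + exp (ln lam / 2)) / ?d"
      using lam by (intro rho_split) auto
    then show ?thesis using False by (auto simp: s0_def clip_def max_def)
  qed (simp add: s0_def clip_def)
  then have "(\<Sum>i\<in>UNIV. lam * exp (- clip lam (s $ i)) + exp (clip lam (s $ i))) / ?d
    = (\<Sum>i\<in>UNIV. of_bool (ereal (s $ i) < s0 lam) * (rho lam / real CARD('n))
      + (lam * exp (- (s $ i)) + exp (s $ i)) * of_bool (ereal (s $ i) \<ge> s0 lam) / ?d)"
    unfolding sum_divide_distrib by simp
  also have "\<dots> = psi lam s"
    unfolding psi_def N_below_def sum.distrib
    by (simp only: sum_divide_distrib[symmetric] sum_distrib_right of_nat_sum of_nat_of_bool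
        times_divide_eq_left mult_1)
  finally show ?thesis by simp
qed

lemma psi_pos:
  assumes lam: "0 \<le> lam" "lam < 1"
  shows "0 < psi lam (s :: real ^ 'n::finite)"
proof -
  have "0 < lam * exp (- c) + exp c" for c
    using lam by (simp add: add_nonneg_pos)
  then show ?thesis
    unfolding psi_clip[OF lam] using lam by (intro divide_pos_pos sum_pos mult_pos_pos) auto
qed

lemma radial_pos: "0 \<le> lam \<Longrightarrow> 0 < radial lam a x"
  unfolding radial_def by (intro add_pos_nonneg) auto

lemma potential_nonneg: "0 \<le> lam \<Longrightarrow> 0 \<le> potential lam s w"
  unfolding potential_def by (intro prod_nonneg) (simp add: radial_pos less_imp_le)

text \<open>The reflection weight \<open>2\<close> at the origin is exactly the one that fits the even eigenfunction, so
  that the hyperplanes create no additional growth.\<close>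

lemma radial_eigenfunction:
  "(if x = 0 then 2 * radial lam a 1 else radial lam a (Suc x) + lam * radial lam a (x - 1))
    = (lam * exp (- a) + exp a) * radial lam a x"
proof (cases x)
  case (Suc y)
  have "exp (a * real (Suc (Suc y))) = exp a * exp a * exp (a * real y)"
    "exp (a * real (Suc y)) = exp a * exp (a * real y)"
    "exp (- (a * real (Suc (Suc y)))) = exp (- a) * exp (- a) * exp (- (a * real y))"
    "exp (- (a * real (Suc y))) = exp (- a) * exp (- (a * real y))"
    by (simp_all add: exp_add[symmetric] algebra_simps)
  moreover have "E * E * P + lam * (lam * q) * (E' * E' * P') + lam * (P + q * P')
      = (lam * E' + E) * (E * P + lam * q * (E' * P'))" if "E * E' = 1" for E E' P P' q :: real
    using that by algebra
  moreover have "exp a * exp (- a) = 1" by (simp add: exp_minus)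
  ultimately have "radial lam a (Suc (Suc y)) + lam * radial lam a y
      = (lam * exp (- a) + exp a) * radial lam a (Suc y)"
    unfolding radial_def power_Suc by simp
  then show ?thesis using Suc by simp
qed (simp add: radial_def)

lemma prod_upd:
  fixes w :: "'n::finite \<Rightarrow> nat" and g :: "'n \<Rightarrow> nat \<Rightarrow> real"
  shows "(\<Prod>j\<in>UNIV. g j ((w(i := x)) j)) = g i x * (\<Prod>j\<in>UNIV - {i}. g j (w j))"
  by (subst prod.remove[of _ i]) auto

text \<open>Each coordinate contributes its one-dimensional eigenvalue, and their sum is
  \<open>d * (1 + lam) * psi lam s\<close>; the inequality comes from \<open>total_rate_ge\<close>.\<close>

lemma folded_step_potential:
  fixes s :: "real ^ 'n::finite"
  assumes lam: "0 \<le> lam" "lam < 1"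
  shows "folded_step lam (potential lam s) w \<le> psi lam s * potential lam s w"
proof -
  let ?g = "\<lambda>i. radial lam (clip lam (s $ i))"
  let ?th = "\<lambda>i. lam * exp (- clip lam (s $ i)) + exp (clip lam (s $ i))"
  have "(if w i = 0 then 2 * potential lam s (w(i := 1))
      else potential lam s (w(i := Suc (w i))) + lam * potential lam s (w(i := w i - 1)))
    = ?th i * potential lam s w" for i
  proof -
    have p: "potential lam s (w(i := x)) = ?g i x * (\<Prod>j\<in>UNIV - {i}. ?g j (w j))" for x
      unfolding potential_def by (rule prod_upd)
    have "(if w i = 0 then 2 * potential lam s (w(i := 1))
      else potential lam s (w(i := Suc (w i))) + lam * potential lam s (w(i := w i - 1)))
     = (if w i = 0 then 2 * ?g i 1 else ?g i (Suc (w i)) + lam * ?g i (w i - 1))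
      * (\<Prod>j\<in>UNIV - {i}. ?g j (w j))"
      unfolding p by (simp add: algebra_simps)
    also have "\<dots> = ?th i * (?g i (w i) * (\<Prod>j\<in>UNIV - {i}. ?g j (w j)))"
      unfolding radial_eigenfunction by simp
    also have "?g i (w i) * (\<Prod>j\<in>UNIV - {i}. ?g j (w j)) = potential lam s w"
      using p[of "w i"] by simp
    finally show ?thesis .
  qed
  then have "folded_step lam (potential lam s) w
      = (\<Sum>i\<in>UNIV. ?th i) * potential lam s w / total_rate lam w"
    unfolding folded_step_def by (simp add: sum_distrib_right)
  also have "\<dots> \<le> (\<Sum>i\<in>UNIV. ?th i) * potential lam s w / (real CARD('n) * (1 + lam))"
    using lam potential_nonneg[OF lam(1), of s w]
    by (intro divide_left_mono total_rate_ge mult_nonneg_nonneg sum_nonneg add_nonneg_nonneg mult_pos_pos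
        total_rate_pos) auto
  also have "\<dots> = psi lam s * potential lam s w"
    unfolding psi_clip[OF lam] by simp
  finally show ?thesis .
qed

lemma exp_le_potential:
  fixes s :: "real ^ 'n::finite"
  assumes "0 \<le> lam"
  shows "exp (\<Sum>i\<in>UNIV. s $ i * real (w i)) \<le> potential lam s w"
  unfolding exp_sum[OF finite] potential_def
proof (rule prod_mono, safe)
  fix i
  have "s $ i \<le> clip lam (s $ i)" by (simp add: clip_def)
  then have "exp (s $ i * real (w i)) \<le> exp (clip lam (s $ i) * real (w i))"
    by (simp add: mult_right_mono)
  also have "\<dots> \<le> radial lam (clip lam (s $ i)) (w i)"
    using assms by (simp add: radial_def)
  finally show "exp (s $ i * real (w i)) \<le> radial lam (clip lam (s $ i)) (w i)" .
qed simp

definition scaled :: "nat \<Rightarrow> ('n::finite \<Rightarrow> nat) \<Rightarrow> real ^ 'n" where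
  "scaled n w = (\<chi> i. real (w i) / real n)"

lemma inner_scaled: "s \<bullet> scaled n w = (\<Sum>i\<in>UNIV. s $ i * real (w i)) / real n"
  by (simp add: inner_vec_def scaled_def sum_divide_distrib)

context folded_walk
begin

text \<open>Markov's inequality for the potential; the constant \<open>potential lam s w0\<close> does not depend on \<open>n\<close>, so
  the starting point is invisible at exponential scale.\<close>

lemma half_space_bound:
  assumes n: "n > 0"
  shows "prob {\<omega> \<in> space M. s \<bullet> scaled n (W n \<omega>) - ln (psi lam s) \<ge> b}
    \<le> exp (- (real n * b)) * potential lam s w0"
proof -
  let ?A = "{\<omega> \<in> space M. s \<bullet> scaled n (W n \<omega>) - ln (psi lam s) \<ge> b}"
  have psi: "0 < psi lam s" by (rule psi_pos[OF lam])
  have A: "?A \<in> sets M" by measurable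
  have le: "psi lam s ^ n * exp (real n * b) \<le> potential lam s (W n \<omega>)" if "\<omega> \<in> ?A" for \<omega>
  proof -
    have "ln (psi lam s) + b \<le> (\<Sum>i\<in>UNIV. s $ i * real (W n \<omega> i)) / real n"
      using that by (simp add: inner_scaled)
    then have "real n * (ln (psi lam s) + b) \<le> (\<Sum>i\<in>UNIV. s $ i * real (W n \<omega> i))"
      using n by (simp add: field_simps)
    then have "exp (real n * ln (psi lam s) + real n * b) \<le> exp (\<Sum>i\<in>UNIV. s $ i * real (W n \<omega> i))"
      by (simp add: algebra_simps)
    also have "\<dots> \<le> potential lam s (W n \<omega>)" by (rule exp_le_potential[OF lam(1)])
    finally show ?thesis using psi by (simp add: exp_add exp_of_nat_mult)
  qed
  have "ennreal (psi lam s ^ n * exp (real n * b) * prob ?A)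
      = (\<integral>\<^sup>+\<omega>. ennreal (psi lam s ^ n * exp (real n * b)) * indicator ?A \<omega> \<partial>M)"
    using A psi by (simp add: nn_integral_cmult_indicator emeasure_eq_measure ennreal_mult')
  also have "\<dots> \<le> (\<integral>\<^sup>+\<omega>. ennreal (potential lam s (W n \<omega>)) \<partial>M)"
    using le by (intro nn_integral_mono) (auto simp: indicator_def intro!: ennreal_leI)
  also have "\<dots> \<le> ennreal (psi lam s ^ n * potential lam s w0)"
    using psi by (intro expectation_le_power folded_step_potential lam potential_nonneg) auto
  finally have "ennreal (psi lam s ^ n * exp (real n * b) * prob ?A)
      \<le> ennreal (psi lam s ^ n * potential lam s w0)" .
  moreover have "0 \<le> psi lam s ^ n * potential lam s w0"
    using psi by (intro mult_nonneg_nonneg potential_nonneg lam) auto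
  ultimately have "psi lam s ^ n * exp (real n * b) * prob ?A \<le> psi lam s ^ n * potential lam s w0"
    by (simp only: ennreal_le_iff)
  then have "exp (real n * b) * prob ?A \<le> potential lam s w0"
    using psi by (simp add: mult.assoc)
  then show ?thesis by (simp add: exp_minus field_simps)
qed

end

section \<open>The upper bound\<close>

lemma limsup_rate_le:
  fixes p :: "nat \<Rightarrow> real"
  assumes p: "\<And>n. 0 \<le> p n" and C: "C > 0" and le: "\<And>n. n > 0 \<Longrightarrow> p n \<le> C * exp (- (real n * a))"
  shows "limsup (\<lambda>n. ereal (1 / real n) * ext_ln (p n)) \<le> ereal (- a)"
proof -
  have "ereal (1 / real n) * ext_ln (p n) \<le> ereal (ln C * (1 / real n) - a)" if n: "n > 0" for n
  proof (cases "p n = 0")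
    case False
    with p[of n] have pos: "0 < p n" by simp
    have "ln (p n) \<le> ln (C * exp (- (real n * a)))"
      using pos le[OF n] by (intro ln_mono) auto
    also have "\<dots> = ln C - real n * a" using C by (simp add: ln_mult)
    finally have "ln (p n) / real n \<le> (ln C - real n * a) / real n"
      using n by (simp add: divide_right_mono)
    also have "\<dots> = ln C * (1 / real n) - a" using n by (simp add: field_simps)
    finally show ?thesis using False by (simp add: ext_ln_def)
  qed (use n in \<open>simp add: ext_ln_def\<close>)
  then have "limsup (\<lambda>n. ereal (1 / real n) * ext_ln (p n)) \<le> limsup (\<lambda>n. ereal (ln C * (1 / real n) - a))"
    by (intro Limsup_mono eventually_mono[OF eventually_gt_at_top[of 0]]) auto
  also have "(\<lambda>n. ln C * (1 / real n) - a) \<longlonglongrightarrow> ln C * 0 - a"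
    by (intro tendsto_intros lim_1_over_n)
  then have "(\<lambda>n. ereal (ln C * (1 / real n) - a)) \<longlonglongrightarrow> ereal (- a)"
    by simp
  then have "limsup (\<lambda>n. ereal (ln C * (1 / real n) - a)) = ereal (- a)"
    by (rule lim_imp_Limsup[rotated]) simp
  finally show ?thesis .
qed

text \<open>The shift by \<open>m\<close> allows for an initial stretch of fixed length during which the walk moves to a
  convenient starting point.\<close>

lemma liminf_rate_ge:
  fixes p :: "nat \<Rightarrow> real"
  assumes c: "c > 0" and ge: "\<forall>\<^sub>F N in sequentially. c * exp (real N * L) \<le> p (m + N)"
  shows "ereal L \<le> liminf (\<lambda>n. ereal (1 / real n) * ext_ln (p n))"
proof -
  let ?f = "\<lambda>n. ereal (1 / real n) * ext_ln (p n)"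
  let ?g = "\<lambda>N. ln c * (1 / real (N + m)) + (1 - real m * (1 / real (N + m))) * L"
  have lim0: "(\<lambda>N. 1 / real (N + m)) \<longlonglongrightarrow> 0"
    using LIMSEQ_ignore_initial_segment[OF lim_1_over_n, of m] by simp
  have "?g \<longlonglongrightarrow> ln c * 0 + (1 - real m * 0) * L"
    by (intro tendsto_intros lim0)
  then have "(\<lambda>N. ereal (?g N)) \<longlonglongrightarrow> ereal L" by simp
  then have "ereal L = liminf (\<lambda>N. ereal (?g N))"
    by (intro lim_imp_Liminf[symmetric]) auto
  also have "\<dots> \<le> liminf (\<lambda>N. ?f (N + m))"
  proof (rule Liminf_mono, rule eventually_mono[OF eventually_conj[OF ge eventually_gt_at_top[of 0]]])
    fix N assume N: "c * exp (real N * L) \<le> p (m + N) \<and> 0 < N"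
    have pos: "0 < c * exp (real N * L)" using c by simp
    then have "ln (c * exp (real N * L)) \<le> ln (p (m + N))"
      using N by (intro ln_mono) auto
    then have "(ln c + real N * L) / real (N + m) \<le> ln (p (N + m)) / real (N + m)"
      using c by (intro divide_right_mono) (simp_all add: ln_mult add.commute)
    also have "(ln c + real N * L) / real (N + m) = ?g N"
    proof -
      have "(ln c + (k - l) * L) / k = ln c * (1 / k) + (1 - l * (1 / k)) * L" if "k > 0" for k l :: real
        using that by (simp add: field_simps)
      from this[of "real (N + m)" "real m"] show ?thesis using N by simp
    qed
    finally show "ereal (?g N) \<le> ?f (N + m)"
      using pos N by (auto simp: ext_ln_def add.commute)
  qed
  also have "\<dots> = liminf ?f" by (rule liminf_shift_k)
  finally show ?thesis .
qed

text \<open>In the direction \<open>(1, ..., 1)\<close> the walk cannot grow faster than by one per step.\<close>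

lemma psi_diagonal_le:
  assumes lam: "0 \<le> lam" "lam < 1" and c: "0 \<le> c"
  shows "psi lam ((\<chi> i. c) :: real ^ 'n::finite) \<le> exp c"
proof -
  have "clip lam c = c" by (rule clip_nonneg[OF lam c])
  then have "psi lam ((\<chi> i. c) :: real ^ 'n) = (lam * exp (- c) + exp c) / (1 + lam)"
    by (simp add: psi_clip[OF lam])
  also have "lam * exp (- c) \<le> lam * exp c" using lam c by (intro mult_left_mono) auto
  then have "(lam * exp (- c) + exp c) / (1 + lam) \<le> exp c"
    using lam by (simp add: field_simps)
  finally show ?thesis .
qed

context folded_walk
begin

text \<open>Where \<open>Lambda_star\<close> exceeds \<open>a\<close>, some half space on which \<open>s \<bullet> y - ln (psi lam s) > a\<close> contains the
  point. Finitely many of them cover the part of \<open>F\<close> in a cube, and one more, with normal vector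
  along the diagonal, covers all nonnegative points outside the cube.\<close>

lemma closed_set_bound:
  fixes F :: "(real ^ 'n) set"
  assumes F: "closed F" and a: "ereal a < (INF x\<in>F. Lambda_star lam x)"
  shows "\<exists>C>0. \<forall>n>0. prob {\<omega> \<in> space M. scaled n (W n \<omega>) \<in> F} \<le> C * exp (- (real n * a))"
proof -
  define U where "U s = {y :: real ^ 'n. s \<bullet> y - ln (psi lam s) > a}" for s
  define K where "K = F \<inter> cbox 0 (\<chi> i. 2)"
  have "compact K" unfolding K_def using F by (simp add: closed_Int_compact)
  moreover have "open (U s)" for s
    unfolding U_def by (intro open_Collect_less continuous_intros)
  moreover have "K \<subseteq> (\<Union>s\<in>UNIV. U s)"
  proof
    fix x assume "x \<in> K"
    then have "(INF x\<in>F. Lambda_star lam x) \<le> Lambda_star lam x"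
      unfolding K_def by (intro INF_lower) auto
    with a have "ereal a < (SUP s. ereal (s \<bullet> x - ln (psi lam s)))"
      unfolding Lambda_star_def by order
    then show "x \<in> (\<Union>s\<in>UNIV. U s)" by (auto simp: less_SUP_iff U_def)
  qed
  ultimately obtain T where T: "finite T" "K \<subseteq> (\<Union>s\<in>T. U s)"
    by (rule compactE_image) auto
  \<comment> \<open>a diagonal slope \<open>c\<close> has value at least \<open>2 * c - c\<close> where the sum of the coordinates is at least \<open>2\<close>; this must exceed \<open>a\<close>\<close>
  define c where "c = max a 0 + 1"
  define T' where "T' = insert (\<chi> i. c) T"
  have fin: "finite T'" using T by (simp add: T'_def)
  have cover: "\<exists>s\<in>T'. scaled n w \<in> U s" if w: "scaled n w \<in> F" for n w
  proof (cases "scaled n w \<in> K")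
    case False
    let ?y = "scaled n w"
    have nonneg: "0 \<le> ?y $ i" for i by (simp add: scaled_def)
    with False w obtain i where "2 < ?y $ i"
      unfolding K_def by (auto simp: mem_box_cart not_le)
    also have "?y $ i \<le> (\<Sum>i\<in>UNIV. ?y $ i)"
      using nonneg by (intro member_le_sum) auto
    finally have "c * 2 < c * (\<Sum>i\<in>UNIV. ?y $ i)"
      by (intro mult_strict_left_mono) (auto simp: c_def)
    moreover have "ln (psi lam ((\<chi> i. c) :: real ^ 'n)) \<le> ln (exp c)"
      by (intro ln_mono psi_diagonal_le psi_pos lam) (auto simp: c_def)
    moreover have "a < c" by (simp add: c_def)
    moreover have "((\<chi> i. c) :: real ^ 'n) \<bullet> ?y = c * (\<Sum>i\<in>UNIV. ?y $ i)"
      by (simp add: inner_vec_def sum_distrib_left)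
    ultimately have "?y \<in> U (\<chi> i. c)" by (simp add: U_def)
    then show ?thesis by (simp add: T'_def)
  qed (use T in \<open>auto simp: T'_def\<close>)
  define C where "C = (\<Sum>s\<in>T'. potential lam s w0) + 1"
  have "prob {\<omega> \<in> space M. scaled n (W n \<omega>) \<in> F} \<le> C * exp (- (real n * a))" if n: "n > 0" for n
  proof -
    let ?A = "\<lambda>s. {\<omega> \<in> space M. s \<bullet> scaled n (W n \<omega>) - ln (psi lam s) \<ge> a}"
    have A: "?A s \<in> events" for s by measurable
    have "prob {\<omega> \<in> space M. scaled n (W n \<omega>) \<in> F} \<le> prob (\<Union>s\<in>T'. ?A s)"
    proof (rule finite_measure_mono)
      show "{\<omega> \<in> space M. scaled n (W n \<omega>) \<in> F} \<subseteq> (\<Union>s\<in>T'. ?A s)"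
      proof
        fix \<omega> assume w: "\<omega> \<in> {\<omega> \<in> space M. scaled n (W n \<omega>) \<in> F}"
        then obtain s where "s \<in> T'" "scaled n (W n \<omega>) \<in> U s" using cover by blast
        then show "\<omega> \<in> (\<Union>s\<in>T'. ?A s)" using w by (auto simp: U_def intro!: bexI[of _ s])
      qed
    qed (use A fin in auto)
    also have "\<dots> \<le> (\<Sum>s\<in>T'. prob (?A s))"
      by (rule finite_measure_subadditive_finite[OF fin]) (use A in auto)
    also have "\<dots> \<le> (\<Sum>s\<in>T'. exp (- (real n * a)) * potential lam s w0)"
      by (intro sum_mono half_space_bound n)
    also have "\<dots> \<le> C * exp (- (real n * a))"
      unfolding C_def sum_distrib_left[symmetric] by (simp add: algebra_simps)
    finally show ?thesis .
  qed
  moreover have "C > 0"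
    unfolding C_def by (intro add_nonneg_pos sum_nonneg potential_nonneg lam) auto
  ultimately show ?thesis by blast
qed

lemma limsup_closed_le:
  fixes F :: "(real ^ 'n) set"
  assumes F: "closed F"
  shows "limsup (\<lambda>n. ereal (1 / real n) * ext_ln (prob {\<omega> \<in> space M. scaled n (W n \<omega>) \<in> F}))
    \<le> - (INF x\<in>F. Lambda_star lam x)" (is "?L \<le> - ?I")
proof (rule ereal_le_real)
  fix z assume "- ?I \<le> ereal z"
  then have z: "ereal (- z) \<le> ?I"
    by (simp add: ereal_uminus_le_reorder)
  show "?L \<le> ereal z"
  proof (rule ereal_le_epsilon2)
    fix e :: real assume "0 < e"
    then have "ereal (- z - e) < ereal (- z)" by simp
    then have "ereal (- z - e) < ?I" using z by (rule less_le_trans)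
    from closed_set_bound[OF F this] obtain C where "C > 0"
      "\<And>n. n > 0 \<Longrightarrow> prob {\<omega> \<in> space M. scaled n (W n \<omega>) \<in> F} \<le> C * exp (- (real n * (- z - e)))"
      by blast
    then have "?L \<le> ereal (- (- z - e))" by (intro limsup_rate_le measure_nonneg)
    then show "?L \<le> ereal z + ereal e" by (simp add: add.commute)
  qed
qed

end

section \<open>The lower bound along tilted walks\<close>

text \<open>For a one-dimensional walk going up with probability \<open>p\<close> and down with probability \<open>q < p\<close>, the term
  \<open>(q / p) ^ w\<close> is the probability of ever reaching \<open>0\<close> from \<open>w\<close>, and the second term bounds, by
  Chebyshev's inequality, the probability that after \<open>k\<close> further steps the walk is at distance at
  least \<open>L\<close> from \<open>N * (p - q)\<close>.\<close>

definition barrier :: "real \<Rightarrow> real \<Rightarrow> real \<Rightarrow> real \<Rightarrow> nat \<Rightarrow> nat \<Rightarrow> real" where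
  "barrier p q N L k w = (q / p) ^ w + ((real w - (N - real k) * (p - q))\<^sup>2 + real k) / L\<^sup>2"

lemma barrier_nonneg: "0 < p \<Longrightarrow> 0 \<le> q \<Longrightarrow> 0 \<le> barrier p q N L k w"
  unfolding barrier_def by simp

text \<open>The geometric term is harmonic for the lazy walk. The quadratic term gains the variance of one
  step, \<open>p + q - (p - q)^2\<close>, which is at most the \<open>1\<close> that is added in passing from \<open>k\<close> to \<open>Suc k\<close>.\<close>

lemma barrier_supersolution:
  assumes p: "0 < p" and q: "0 \<le> q" and pq: "p + q \<le> 1"
  shows "p * barrier p q N L k (w + 2) + q * barrier p q N L k w
      + (1 - p - q) * barrier p q N L k (w + 1) \<le> barrier p q N L (Suc k) (w + 1)"
proof -
  define r where "r = q / p"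
  define b where "b = real w + 1 - (N - real k) * (p - q)"
  have q_eq: "q = p * r" using p by (simp add: r_def)
  have geom: "p * r ^ (w + 2) + q * r ^ w + (1 - p - q) * r ^ (w + 1) = r ^ (w + 1)"
    unfolding q_eq by (simp add: algebra_simps)
  have "p * ((b + 1)\<^sup>2 + real k) + q * ((b - 1)\<^sup>2 + real k) + (1 - p - q) * (b\<^sup>2 + real k)
      = (b + (p - q))\<^sup>2 + real k + (p + q - (p - q)\<^sup>2)"
    by (simp add: power2_eq_square algebra_simps)
  also have "\<dots> \<le> (b + (p - q))\<^sup>2 + (real k + 1)"
    using pq zero_le_power2[of "p - q"] by linarith
  finally have quad: "p * ((b + 1)\<^sup>2 + real k) + q * ((b - 1)\<^sup>2 + real k) + (1 - p - q) * (b\<^sup>2 + real k)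
      \<le> (b + (p - q))\<^sup>2 + (real k + 1)" .
  have 1: "barrier p q N L k (w + 2) = r ^ (w + 2) + ((b + 1)\<^sup>2 + real k) / L\<^sup>2"
    "barrier p q N L k w = r ^ w + ((b - 1)\<^sup>2 + real k) / L\<^sup>2"
    "barrier p q N L k (w + 1) = r ^ (w + 1) + (b\<^sup>2 + real k) / L\<^sup>2"
    "barrier p q N L (Suc k) (w + 1) = r ^ (w + 1) + ((b + (p - q))\<^sup>2 + (real k + 1)) / L\<^sup>2"
    unfolding barrier_def r_def b_def by (simp_all add: algebra_simps)
  have "p * barrier p q N L k (w + 2) + q * barrier p q N L k w
      + (1 - p - q) * barrier p q N L k (w + 1)
    = (p * r ^ (w + 2) + q * r ^ w + (1 - p - q) * r ^ (w + 1)) +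
     (p * ((b + 1)\<^sup>2 + real k) + q * ((b - 1)\<^sup>2 + real k) + (1 - p - q) * (b\<^sup>2 + real k)) / L\<^sup>2"
    unfolding 1 by (simp add: add_divide_distrib distrib_left)
  also have "\<dots> \<le> r ^ (w + 1) + ((b + (p - q))\<^sup>2 + (real k + 1)) / L\<^sup>2"
    unfolding geom by (intro add_left_mono divide_right_mono quad) simp
  finally show ?thesis unfolding 1 .
qed

lemma sum_upd:
  fixes w :: "'n::finite \<Rightarrow> nat" and g :: "'n \<Rightarrow> nat \<Rightarrow> real"
  shows "(\<Sum>j\<in>UNIV. g j ((w(i := x)) j)) = (\<Sum>j\<in>UNIV. g j (w j)) - g i (w i) + g i x"
proof -
  have "(\<Sum>j\<in>UNIV - {i}. g j ((w(i := x)) j)) = (\<Sum>j\<in>UNIV - {i}. g j (w j))"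
    by (rule sum.cong) auto
  then show ?thesis by (simp add: sum.remove[of UNIV i])
qed

text \<open>The left-hand side is a subsolution for the number \<open>k\<close> of remaining steps. At \<open>k = 0\<close> it is at most
  the indicator of the box: on the box the exponential is at most \<open>1\<close>, and outside it, some barrier is at
  least \<open>1\<close>. Where a coordinate vanishes its barrier is at least \<open>1\<close>, so the left-hand side is
  nonpositive, hence below any nonnegative function. Elsewhere the folded operator has the
  homogeneous weights, and tilting by \<open>exp (s \<bullet> w)\<close> turns them into the probabilities \<open>p\<close> and \<open>q\<close> at
  the price of the factor \<open>Z / (d * (1 + lam)) = psi lam s\<close> per step.\<close>

lemma folded_iterate_lower:
  fixes lam :: real and s :: "real ^ 'n::finite" and p q :: "'n \<Rightarrow> real"
  defines "Z \<equiv> (\<Sum>i\<in>UNIV. exp (s $ i) + lam * exp (- (s $ i)))"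
  assumes lam: "0 \<le> lam" "lam < 1"
    and p: "\<And>i. p i = exp (s $ i) / Z" and q: "\<And>i. q i = lam * exp (- (s $ i)) / Z"
    and L: "0 < L"
  shows "(Z / (real CARD('n) * (1 + lam))) ^ k *
      exp ((\<Sum>i\<in>UNIV. s $ i * real (w i)) - (\<Sum>i\<in>UNIV. s $ i * (N * (p i - q i)) + \<bar>s $ i\<bar> * L))
      * (1 - (\<Sum>i\<in>UNIV. barrier (p i) (q i) N L k (w i)))
    \<le> (folded_step lam ^^ k) (\<lambda>w. of_bool (\<forall>i. \<bar>real (w i) - N * (p i - q i)\<bar> < L)) w"
proof -
  define D where "D = real CARD('n) * (1 + lam)"
  define E where "E = (\<Sum>i\<in>UNIV. s $ i * (N * (p i - q i)) + \<bar>s $ i\<bar> * L)"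
  define f where "f = (\<lambda>w. of_bool (\<forall>i. \<bar>real (w i) - N * (p i - q i)\<bar> < L) :: real)"
  define e where "e w = exp ((\<Sum>i\<in>UNIV. s $ i * real (w i)) - E)" for w
  define S where "S k w = (\<Sum>i\<in>UNIV. barrier (p i) (q i) N L k (w i))" for k w
  have D: "0 < D" unfolding D_def using lam by (intro mult_pos_pos) auto
  have Z: "0 < Z" unfolding Z_def using lam by (intro sum_pos add_pos_nonneg) auto
  have pos: "0 < p i" "0 \<le> q i" for i using Z lam by (simp_all add: p q)
  have sum_pq: "(\<Sum>i\<in>UNIV. p i + q i) = 1"
    unfolding p q add_divide_distrib[symmetric] sum_divide_distrib[symmetric] Z_def[symmetric]
    using Z by simp
  have pq_le: "p i + q i \<le> 1" for i
    using member_le_sum[of i UNIV "\<lambda>i. p i + q i"] pos sum_pq by (simp add: add_nonneg_nonneg less_imp_le)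
  have S_ge: "barrier (p i) (q i) N L k (w i) \<le> S k w" for i k w
    unfolding S_def using pos by (intro member_le_sum barrier_nonneg) auto
  have fk_nonneg: "0 \<le> (folded_step lam ^^ k) f w" for k w
  proof (induction k arbitrary: w)
    case (Suc k)
    then show ?case by (simp add: folded_step_nonneg[OF lam])
  qed (simp add: f_def)
  have e_pos: "0 < e w" for w by (simp add: e_def)
  have "(Z / D) ^ k * e w * (1 - S k w) \<le> (folded_step lam ^^ k) f w"
  proof (induction k arbitrary: w)
    case 0
    show ?case
    proof (cases "\<forall>i. \<bar>real (w i) - N * (p i - q i)\<bar> < L")
      case True
      have "s $ i * real (w i) \<le> s $ i * (N * (p i - q i)) + \<bar>s $ i\<bar> * L" for i
      proof -
        have "s $ i * (real (w i) - N * (p i - q i)) \<le> \<bar>s $ i\<bar> * \<bar>real (w i) - N * (p i - q i)\<bar>"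
          by (metis abs_ge_self abs_mult)
        also have "\<dots> \<le> \<bar>s $ i\<bar> * L"
          using True by (intro mult_left_mono) (auto simp: less_imp_le)
        finally show ?thesis by (simp add: algebra_simps)
      qed
      then have "(\<Sum>i\<in>UNIV. s $ i * real (w i)) \<le> E" unfolding E_def by (intro sum_mono)
      then have e_le: "e w \<le> 1" by (simp add: e_def)
      have "0 \<le> S 0 w" unfolding S_def using pos by (intro sum_nonneg barrier_nonneg)
      then have "e w * (1 - S 0 w) \<le> e w * 1"
        using e_pos[of w] by (intro mult_left_mono) auto
      with e_le have "e w * (1 - S 0 w) \<le> 1" by simp
      then show ?thesis using True by (simp add: f_def)
    next
      case False
      then obtain i where "L \<le> \<bar>real (w i) - N * (p i - q i)\<bar>" by (auto simp: not_less)
      then have "L\<^sup>2 \<le> \<bar>real (w i) - N * (p i - q i)\<bar>\<^sup>2"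
        using L by (intro power_mono) auto
      then have "L\<^sup>2 \<le> (real (w i) - N * (p i - q i))\<^sup>2" by simp
      then have "1 \<le> (real (w i) - N * (p i - q i))\<^sup>2 / L\<^sup>2"
        using L by simp
      also have "\<dots> \<le> barrier (p i) (q i) N L 0 (w i)"
        using pos[of i] by (simp add: barrier_def)
      also have "\<dots> \<le> S 0 w" by (rule S_ge)
      finally have "e w * (1 - S 0 w) \<le> 0"
        using e_pos[of w] by (simp add: mult_le_0_iff)
      then show ?thesis using fk_nonneg[of 0 w] by simp
    qed
  next
    case (Suc k)
    show ?case
    proof (cases "\<exists>i. w i = 0")
      case True
      then obtain i where "w i = 0" by blast
      then have "1 \<le> barrier (p i) (q i) N L (Suc k) (w i)" by (simp add: barrier_def)
      also have "\<dots> \<le> S (Suc k) w" by (rule S_ge)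
      finally have "(Z / D) ^ Suc k * e w * (1 - S (Suc k) w) \<le> 0"
        using e_pos[of w] Z D by (intro mult_nonneg_nonpos mult_nonneg_nonneg zero_le_power) auto
      then show ?thesis using fk_nonneg[of "Suc k" w] by simp
    next
      case False
      then have w: "w i \<noteq> 0" for i by simp
      define H where "H w = (Z / D) ^ k * e w * (1 - S k w)" for w
      let ?b = "\<lambda>i. barrier (p i) (q i) N L k"
      have H_upd: "H (w(i := x)) = (Z / D) ^ k * e w * (exp (s $ i * (real x - real (w i)))
          * (1 - S k w + ?b i (w i) - ?b i x))" for i x
      proof -
        have e_upd: "e (w(i := x)) = e w * exp (s $ i * (real x - real (w i)))"
          unfolding e_def using sum_upd[of "\<lambda>i n. s $ i * real n" w i x]
          by (simp add: exp_add[symmetric] algebra_simps)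
        have S_upd: "S k (w(i := x)) = S k w - ?b i (w i) + ?b i x"
          unfolding S_def by (rule sum_upd)
        show ?thesis unfolding H_def e_upd S_upd by (simp add: algebra_simps)
      qed
      have H_sum: "H (w(i := Suc (w i))) + lam * H (w(i := w i - 1))
          = Z * ((Z / D) ^ k * e w) * ((p i + q i) * (1 - S k w + ?b i (w i))
            - (p i * ?b i (w i + 1) + q i * ?b i (w i - 1)))" for i
      proof -
        have e1: "exp (s $ i * (real (Suc (w i)) - real (w i))) = Z * p i"
          using Z by (simp add: p)
        have e2: "lam * exp (s $ i * (real (w i - 1) - real (w i))) = Z * q i"
          using Z w[of i] by (simp add: q of_nat_diff)
        have "H (w(i := Suc (w i))) + lam * H (w(i := w i - 1))
          = (Z / D) ^ k * e w * (exp (s $ i * (real (Suc (w i)) - real (w i)))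
              * (1 - S k w + ?b i (w i) - ?b i (Suc (w i)))
            + lam * exp (s $ i * (real (w i - 1) - real (w i)))
              * (1 - S k w + ?b i (w i) - ?b i (w i - 1)))"
          unfolding H_upd by (simp only: algebra_simps)
        then show ?thesis unfolding e1 e2 by (simp add: algebra_simps)
      qed
      have b_le: "?b i (w i) + (p i * ?b i (w i + 1) + q i * ?b i (w i - 1)) - (p i + q i) * ?b i (w i)
          \<le> barrier (p i) (q i) N L (Suc k) (w i)" for i
      proof -
        obtain v where v: "w i = v + 1" using w[of i] by (metis Suc_eq_plus1 not0_implies_Suc)
        show ?thesis
          using barrier_supersolution[OF pos(1)[of i] pos(2)[of i] pq_le[of i], of N L k v]
          unfolding v by (simp add: algebra_simps)
      qed
      have "1 - S (Suc k) w \<le> 1 - (\<Sum>i\<in>UNIV. ?b i (w i)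
          + (p i * ?b i (w i + 1) + q i * ?b i (w i - 1)) - (p i + q i) * ?b i (w i))"
        unfolding S_def using b_le by (intro diff_left_mono sum_mono)
      also have "\<dots> = (\<Sum>i\<in>UNIV. p i + q i) * (1 - S k w)
          + (\<Sum>i\<in>UNIV. (p i + q i) * ?b i (w i)
            - (p i * ?b i (w i + 1) + q i * ?b i (w i - 1)))"
        unfolding sum_pq S_def by (simp add: sum.distrib sum_subtractf)
      also have "\<dots> = (\<Sum>i\<in>UNIV. (p i + q i) * (1 - S k w + ?b i (w i))
            - (p i * ?b i (w i + 1) + q i * ?b i (w i - 1)))" (is "_ = ?R")
        unfolding sum_distrib_right sum.distrib[symmetric]
        by (rule sum.cong) (simp_all add: algebra_simps)
      finally have "1 - S (Suc k) w \<le> ?R" .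
      then have "(Z / D) ^ Suc k * e w * (1 - S (Suc k) w) \<le> (Z / D) ^ Suc k * e w * ?R"
        using e_pos[of w] Z D by (intro mult_left_mono mult_nonneg_nonneg zero_le_power) auto
      also have "\<dots> = Z * ((Z / D) ^ k * e w) * ?R / D" by simp
      also have "\<dots> = folded_step lam H w"
        unfolding folded_step_def total_rate_interior[of w, OF w] D_def[symmetric] sum_distrib_left
        by (intro arg_cong2[where f="(/)"] sum.cong refl) (simp only: w H_sum if_False)
      also have "\<dots> \<le> folded_step lam ((folded_step lam ^^ k) f) w"
        by (rule folded_step_mono[OF lam]) (simp add: H_def Suc.IH)
      finally show ?thesis by simp
    qed
  qed
  then show ?thesis unfolding D_def e_def E_def S_def f_def .
qed

context folded_walk
begin

text \<open>Upward steps always have positive probability, also for \<open>lam = 0\<close>.\<close>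

lemma reachable_far:
  "\<exists>m y. prob {\<omega> \<in> space M. W m \<omega> = y} > 0 \<and> (\<forall>i. K \<le> y i)"
proof -
  define R where "R = {y. \<exists>m. prob {\<omega> \<in> space M. W m \<omega> = y} > 0}"
  have "prob {\<omega> \<in> space M. W 0 \<omega> = w0} = 1"
    using W_start by (subst prob_Collect_eq_1) auto
  then have start: "w0 \<in> R" unfolding R_def by (auto intro!: exI[of _ 0])
  have up: "y(i := Suc (y i)) \<in> R" if y: "y \<in> R" for y i
  proof -
    let ?B = "{y(i := Suc (y i))}"
    let ?f = "\<lambda>w. of_bool (w \<in> ?B) :: real"
    obtain m where m: "prob {\<omega> \<in> space M. W m \<omega> = y} > 0" using y by (auto simp: R_def)
    define g where "g j = (if y j = 0 then 2 * ?f (y(j := 1))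
        else ?f (y(j := Suc (y j))) + lam * ?f (y(j := y j - 1)))" for j
    have "0 < g i" using lam by (simp add: g_def add_pos_nonneg)
    also have "g i \<le> (\<Sum>j\<in>UNIV. g j)"
      using lam by (intro member_le_sum) (auto simp: g_def)
    finally have c: "0 < folded_step lam ?f y"
      using total_rate_pos[OF lam, of y] unfolding folded_step_def g_def by simp
    have "prob {\<omega> \<in> space M. W m \<omega> = y} * folded_step lam ?f y
        \<le> prob {\<omega> \<in> space M. W (m + 1) \<omega> \<in> ?B}"
      by (rule prob_iterate_ge) (use c in auto)
    then have "0 < prob {\<omega> \<in> space M. W (m + 1) \<omega> \<in> ?B}"
      by (rule less_le_trans[OF mult_pos_pos[OF m c]])
    then show ?thesis by (auto simp: R_def intro!: exI[of _ "m + 1"])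
  qed
  have up_many: "y(i := y i + k) \<in> R" if "y \<in> R" for y i k
  proof (induction k)
    case (Suc k)
    have "(y(i := y i + k))(i := Suc ((y(i := y i + k)) i)) = y(i := y i + Suc k)" by auto
    with up[OF Suc, of i] show ?case by (simp only:)
  qed (use that in simp)
  have "\<exists>y\<in>R. \<forall>i\<in>A. K \<le> y i" if "finite A" for A :: "'n set"
    using that
  proof induction
    case (insert i A)
    then obtain y where y: "y \<in> R" "\<forall>i\<in>A. K \<le> y i" by blast
    then have "y(i := y i + K) \<in> R" by (intro up_many)
    moreover have "\<forall>j\<in>insert i A. K \<le> (y(i := y i + K)) j" using y insert by auto
    ultimately show ?case by blast
  qed (use start in auto)
  from this[of UNIV] obtain y where "y \<in> R" "\<forall>i. K \<le> y i" by auto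
  then show ?thesis by (auto simp: R_def)
qed

text \<open>The starting point is taken so far out that the geometric barriers sum to at most \<open>1 / 2\<close>. The
  quadratic barriers are of order \<open>1 / N\<close> for a box of size proportional to \<open>N\<close>, hence eventually
  below \<open>1 / 4\<close>. The remaining \<open>1 / 4\<close> is the constant in the bound.\<close>

lemma tilted_box_lower:
  fixes s x :: "real ^ 'n"
  assumes s: "\<And>i. clip lam (s $ i) = s $ i"
    and x: "\<And>i. x $ i = (exp (s $ i) - lam * exp (- (s $ i))) / (real CARD('n) * (1 + lam) * psi lam s)"
    and x_pos: "\<And>i. 0 < x $ i" and \<delta>: "0 < \<delta>"
  shows "\<exists>m. \<exists>c>0. \<forall>\<^sub>F N in sequentially. c * exp (real N * (ln (psi lam s) - s \<bullet> x - \<delta> * (\<Sum>i\<in>UNIV. \<bar>s $ i\<bar>)))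
      \<le> prob {\<omega> \<in> space M. \<forall>i. \<bar>real (W (m + N) \<omega> i) - real N * x $ i\<bar> < \<delta> * real N}"
proof -
  define Z where "Z = (\<Sum>i\<in>UNIV. exp (s $ i) + lam * exp (- (s $ i)))"
  define p where "p i = exp (s $ i) / Z" for i
  define q where "q i = lam * exp (- (s $ i)) / Z" for i
  have Z: "0 < Z" unfolding Z_def using lam by (intro sum_pos add_pos_nonneg) auto
  have psi: "psi lam s = Z / (real CARD('n) * (1 + lam))"
    unfolding psi_clip[OF lam] s Z_def by (simp add: add.commute)
  then have "real CARD('n) * (1 + lam) * psi lam s = Z" using lam by simp
  with x have x_eq: "x $ i = p i - q i" for i by (simp add: p_def q_def diff_divide_distrib)
  have pos: "0 < p i" "0 \<le> q i" for i using Z lam by (simp_all add: p_def q_def)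
  define r where "r i = q i / p i" for i
  have r: "0 \<le> r i" "r i < 1" for i
    using pos[of i] x_pos[of i] by (simp_all add: r_def x_eq)
  define d where "d = real CARD('n)"
  have d: "0 < d" by (simp add: d_def)
  have "\<exists>K. \<forall>k\<ge>K. r i ^ k < 1 / (2 * d)" for i
    using order_tendstoD(2)[OF LIMSEQ_power_zero[of "r i"], of "1 / (2 * d)"] r[of i] d
    by (simp add: eventually_sequentially)
  then obtain K where K: "\<And>i k. k \<ge> K i \<Longrightarrow> r i ^ k < 1 / (2 * d)" by metis
  obtain m y where y: "prob {\<omega> \<in> space M. W m \<omega> = y} > 0" "\<And>i. Max (range K) \<le> y i"
    using reachable_far by blast
  have "(\<Sum>i\<in>UNIV. r i ^ y i) \<le> (\<Sum>i\<in>(UNIV :: 'n set). 1 / (2 * d))"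
  proof (rule sum_mono)
    fix i
    have "K i \<le> Max (range K)" by (rule Max_ge) auto
    then have "K i \<le> y i" using y(2)[of i] by linarith
    then show "r i ^ y i \<le> 1 / (2 * d)" using K[of i "y i"] by simp
  qed
  also have "\<dots> = 1 / 2" using d by (simp add: d_def)
  finally have geom: "(\<Sum>i\<in>UNIV. r i ^ y i) \<le> 1 / 2" .
  have "(\<lambda>N. ((real (y i) * (1 / real N))\<^sup>2 + 1 / real N) / \<delta>\<^sup>2) \<longlonglongrightarrow> ((real (y i) * 0)\<^sup>2 + 0) / \<delta>\<^sup>2" for i
    using \<delta> by (intro tendsto_intros lim_1_over_n) auto
  then have "(\<lambda>N. \<Sum>i\<in>UNIV. ((real (y i) * (1 / real N))\<^sup>2 + 1 / real N) / \<delta>\<^sup>2)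
      \<longlonglongrightarrow> (\<Sum>i\<in>(UNIV :: 'n set). 0)"
    by (intro tendsto_sum) simp
  then have quad: "\<forall>\<^sub>F N in sequentially.
      (\<Sum>i\<in>UNIV. ((real (y i) * (1 / real N))\<^sup>2 + 1 / real N) / \<delta>\<^sup>2) < 1 / 4"
    by (intro order_tendstoD(2)) auto
  define A where "A = (\<Sum>i\<in>UNIV. s $ i * real (y i))"
  define c where "c = prob {\<omega> \<in> space M. W m \<omega> = y} * (exp A * (1 / 4))"
  have "c * exp (real N * (ln (psi lam s) - s \<bullet> x - \<delta> * (\<Sum>i\<in>UNIV. \<bar>s $ i\<bar>)))
      \<le> prob {\<omega> \<in> space M. \<forall>i. \<bar>real (W (m + N) \<omega> i) - real N * x $ i\<bar> < \<delta> * real N}"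
    if N: "(\<Sum>i\<in>UNIV. ((real (y i) * (1 / real N))\<^sup>2 + 1 / real N) / \<delta>\<^sup>2) < 1 / 4" "0 < N" for N
  proof -
    let ?B = "{w. \<forall>i. \<bar>real (w i) - real N * x $ i\<bar> < \<delta> * real N}"
    let ?E = "\<Sum>i\<in>UNIV. s $ i * (real N * (p i - q i)) + \<bar>s $ i\<bar> * (\<delta> * real N)"
    have "(\<Sum>i\<in>UNIV. barrier (p i) (q i) (real N) (\<delta> * real N) N (y i))
      = (\<Sum>i\<in>UNIV. r i ^ y i) + (\<Sum>i\<in>UNIV. ((real (y i) * (1 / real N))\<^sup>2 + 1 / real N) / \<delta>\<^sup>2)"
      unfolding sum.distrib[symmetric] barrier_def r_def using N(2) \<delta>
      by (intro sum.cong refl) (simp add: field_simps power2_eq_square)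
    then have S: "1 / 4 \<le> 1 - (\<Sum>i\<in>UNIV. barrier (p i) (q i) (real N) (\<delta> * real N) N (y i))"
      using geom N(1) by linarith
    have E: "?E = real N * (s \<bullet> x + \<delta> * (\<Sum>i\<in>UNIV. \<bar>s $ i\<bar>))"
      by (simp add: inner_vec_def x_eq sum.distrib[symmetric] sum_distrib_left algebra_simps)
    have "exp A * (1 / 4) * exp (real N * (ln (psi lam s) - s \<bullet> x - \<delta> * (\<Sum>i\<in>UNIV. \<bar>s $ i\<bar>)))
        = psi lam s ^ N * exp (A - ?E) * (1 / 4)"
    proof -
      have "psi lam s ^ N = exp (real N * ln (psi lam s))"
        using psi_pos[OF lam, of s] by (simp add: exp_of_nat_mult)
      then show ?thesis unfolding E by (simp add: exp_add[symmetric] algebra_simps)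
    qed
    also have "\<dots> \<le> psi lam s ^ N * exp (A - ?E)
        * (1 - (\<Sum>i\<in>UNIV. barrier (p i) (q i) (real N) (\<delta> * real N) N (y i)))"
      using S psi_pos[OF lam, of s] by (intro mult_left_mono) auto
    also have "\<dots> \<le> (folded_step lam ^^ N)
        (\<lambda>w. of_bool (\<forall>i. \<bar>real (w i) - real N * (p i - q i)\<bar> < \<delta> * real N)) y"
      unfolding psi A_def Z_def
      by (rule folded_iterate_lower[OF lam]) (use \<delta> N(2) in \<open>simp_all add: p_def q_def Z_def\<close>)
    finally have "exp A * (1 / 4) * exp (real N * (ln (psi lam s) - s \<bullet> x - \<delta> * (\<Sum>i\<in>UNIV. \<bar>s $ i\<bar>)))
        \<le> (folded_step lam ^^ N) (\<lambda>w. of_bool (w \<in> ?B)) y"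
      by (simp add: x_eq)
    from prob_iterate_ge[OF _ this, of m] show ?thesis
      unfolding c_def by (simp add: mult.assoc)
  qed
  then have "\<forall>\<^sub>F N in sequentially. c * exp (real N * (ln (psi lam s) - s \<bullet> x - \<delta> * (\<Sum>i\<in>UNIV. \<bar>s $ i\<bar>)))
      \<le> prob {\<omega> \<in> space M. \<forall>i. \<bar>real (W (m + N) \<omega> i) - real N * x $ i\<bar> < \<delta> * real N}"
    by (intro eventually_mono[OF eventually_conj[OF quad eventually_gt_at_top[of 0]]]) blast
  moreover have "c > 0" using y(1) by (simp add: c_def)
  ultimately show ?thesis by blast
qed

lemma liminf_open_ge:
  fixes s x :: "real ^ 'n" and G :: "(real ^ 'n) set"
  assumes s: "\<And>i. clip lam (s $ i) = s $ i"
    and x: "\<And>i. x $ i = (exp (s $ i) - lam * exp (- (s $ i))) / (real CARD('n) * (1 + lam) * psi lam s)"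
    and x_pos: "\<And>i. 0 < x $ i" and G: "open G" "x \<in> G"
  shows "ereal (ln (psi lam s) - s \<bullet> x)
    \<le> liminf (\<lambda>n. ereal (1 / real n) * ext_ln (prob {\<omega> \<in> space M. scaled n (W n \<omega>) \<in> G}))"
    (is "_ \<le> ?L")
proof -
  define T where "T = (\<Sum>i\<in>UNIV. \<bar>s $ i\<bar>)"
  obtain e where e: "0 < e" "ball x e \<subseteq> G" using G by (meson open_contains_ball)
  define d where "d = real CARD('n)"
  have d: "0 < d" by (simp add: d_def)
  have box: "y \<in> G" if "\<And>i. \<bar>y $ i - x $ i\<bar> < e / d" for y
  proof -
    have "norm (y - x) \<le> (\<Sum>i\<in>UNIV. \<bar>(y - x) $ i\<bar>)" by (rule norm_le_l1_cart)
    also have "\<dots> < (\<Sum>i\<in>(UNIV :: 'n set). e / d)"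
      using that by (intro sum_strict_mono) auto
    also have "\<dots> = e" using d by (simp add: d_def)
    finally show ?thesis using e(2) by (auto simp: dist_norm norm_minus_commute)
  qed
  have bound: "ereal (ln (psi lam s) - s \<bullet> x - \<delta> * T) \<le> ?L" if \<delta>: "0 < \<delta>" "2 * \<delta> \<le> e / d" for \<delta>
  proof -
    obtain m c where c: "c > 0" and ev: "\<forall>\<^sub>F N in sequentially.
        c * exp (real N * (ln (psi lam s) - s \<bullet> x - \<delta> * T))
      \<le> prob {\<omega> \<in> space M. \<forall>i. \<bar>real (W (m + N) \<omega> i) - real N * x $ i\<bar> < \<delta> * real N}"
      unfolding T_def using tilted_box_lower[OF s x x_pos \<delta>(1)] by blast
    have "(\<lambda>N. \<Sum>i\<in>UNIV. real m * x $ i * (1 / real N)) \<longlonglongrightarrow> (\<Sum>i\<in>UNIV. real m * x $ i * 0)"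
      by (intro tendsto_intros lim_1_over_n)
    then have "\<forall>\<^sub>F N in sequentially. (\<Sum>i\<in>UNIV. real m * x $ i * (1 / real N)) < \<delta>"
      using \<delta> by (intro order_tendstoD(2)) auto
    then have "\<forall>\<^sub>F N in sequentially. c * exp (real N * (ln (psi lam s) - s \<bullet> x - \<delta> * T))
      \<le> prob {\<omega> \<in> space M. scaled (m + N) (W (m + N) \<omega>) \<in> G}"
      using ev eventually_gt_at_top[of 0]
    proof eventually_elim
      case (elim N)
      have "{\<omega> \<in> space M. \<forall>i. \<bar>real (W (m + N) \<omega> i) - real N * x $ i\<bar> < \<delta> * real N}
        \<subseteq> {\<omega> \<in> space M. scaled (m + N) (W (m + N) \<omega>) \<in> G}"
      proof safe
        fix \<omega> assume w: "\<omega> \<in> space M" "\<forall>i. \<bar>real (W (m + N) \<omega> i) - real N * x $ i\<bar> < \<delta> * real N"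
        show "scaled (m + N) (W (m + N) \<omega>) \<in> G"
        proof (rule box)
          fix i
          let ?v = "real (W (m + N) \<omega> i)"
          have "real m * x $ i * (1 / real N) \<le> (\<Sum>i\<in>UNIV. real m * x $ i * (1 / real N))"
            by (rule member_le_sum) (use x_pos in \<open>auto simp: less_imp_le\<close>)
          then have "real m * x $ i * (1 / real N) < \<delta>" using elim by linarith
          then have "real m * x $ i < \<delta> * real N" using elim by (simp add: field_simps)
          moreover have "\<bar>?v - real (m + N) * x $ i\<bar> \<le> \<bar>?v - real N * x $ i\<bar> + real m * x $ i"
          proof -
            have "0 \<le> real m * x $ i" using x_pos[of i] by simp
            moreover have "?v - real (m + N) * x $ i = (?v - real N * x $ i) - real m * x $ i"
              by (simp add: algebra_simps)
            ultimately show ?thesis by linarith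
          qed
          moreover have "\<bar>?v - real N * x $ i\<bar> < \<delta> * real N" using w by blast
          ultimately have "\<bar>?v - real (m + N) * x $ i\<bar> < 2 * \<delta> * real N" by linarith
          also have "\<dots> \<le> 2 * \<delta> * real (m + N)" using \<delta> by (intro mult_left_mono) auto
          also have "\<dots> \<le> e / d * real (m + N)" using \<delta> by (intro mult_right_mono) auto
          finally have lt: "\<bar>?v - real (m + N) * x $ i\<bar> < e / d * real (m + N)" .
          have mN: "0 < real (m + N)" using elim by simp
          have "\<bar>?v / real (m + N) - x $ i\<bar> = \<bar>?v - real (m + N) * x $ i\<bar> / real (m + N)"
          proof -
            have "?v / real (m + N) - x $ i = (?v - real (m + N) * x $ i) / real (m + N)"
              using mN by (simp add: diff_divide_distrib)
            then show ?thesis using mN by (simp add: abs_divide)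
          qed
          also have "\<dots> < e / d" using lt mN by (subst pos_divide_less_eq)
          finally show "\<bar>scaled (m + N) (W (m + N) \<omega>) $ i - x $ i\<bar> < e / d"
            by (simp add: scaled_def)
        qed
      qed
      then have "prob {\<omega> \<in> space M. \<forall>i. \<bar>real (W (m + N) \<omega> i) - real N * x $ i\<bar> < \<delta> * real N}
        \<le> prob {\<omega> \<in> space M. scaled (m + N) (W (m + N) \<omega>) \<in> G}"
        by (rule finite_measure_mono) measurable
      then show ?case using elim by linarith
    qed
    from liminf_rate_ge[OF c, where p="\<lambda>n. prob {\<omega> \<in> space M. scaled n (W n \<omega>) \<in> G}", OF this]
    show ?thesis .
  qed
  show ?thesis
  proof (rule ereal_le_epsilon2)
    fix \<epsilon> :: real assume \<epsilon>: "0 < \<epsilon>"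
    have T: "0 \<le> T" unfolding T_def by (intro sum_nonneg) simp
    \<comment> \<open>small enough for the box to lie in \<open>G\<close> and for the loss \<open>\<delta> * T\<close> to be at most \<open>\<epsilon>\<close>\<close>
    define \<delta> where "\<delta> = min (e / (2 * d)) (\<epsilon> / (T + 1))"
    have "0 < \<delta>" "2 * \<delta> \<le> e / d"
      unfolding \<delta>_def using \<epsilon> e d T by (auto simp: min_def field_simps)
    then have "ereal (ln (psi lam s) - s \<bullet> x - \<delta> * T) + ereal \<epsilon> \<le> ?L + ereal \<epsilon>"
      by (intro add_mono bound) auto
    moreover have "\<delta> * T \<le> \<epsilon>"
    proof -
      have "\<delta> * T \<le> \<epsilon> / (T + 1) * (T + 1)"
        unfolding \<delta>_def using T \<epsilon> by (intro mult_mono) auto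
      then show ?thesis using T by simp
    qed
    then have "ereal (ln (psi lam s) - s \<bullet> x) \<le> ereal (ln (psi lam s) - s \<bullet> x - \<delta> * T) + ereal \<epsilon>"
      by simp
    ultimately show "ereal (ln (psi lam s) - s \<bullet> x) \<le> ?L + ereal \<epsilon>" by order
  qed
qed

end

section \<open>The Gibbs variational principle\<close>

text \<open>The inequality \<open>ln u \<le> u - 1\<close> applied to the ratios of the Gibbs weights to \<open>p\<close>; the convention
  \<open>0 * ln 0 = 0\<close> is harmless because the Gibbs weights are nonnegative.\<close>

lemma gibbs_le:
  fixes p y :: "'b \<Rightarrow> real"
  assumes A: "finite A" "A \<noteq> {}" and p: "\<And>i. i \<in> A \<Longrightarrow> 0 \<le> p i" "(\<Sum>i\<in>A. p i) = 1"
  shows "(\<Sum>i\<in>A. p i * y i) - ln (\<Sum>i\<in>A. exp (y i)) \<le> (\<Sum>i\<in>A. p i * ln (p i))"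
proof -
  define L where "L = ln (\<Sum>i\<in>A. exp (y i))"
  have pos: "0 < (\<Sum>i\<in>A. exp (y i))" using A by (intro sum_pos) auto
  have "p i * (y i - L - ln (p i)) \<le> exp (y i - L) - p i" if "i \<in> A" for i
  proof (cases "p i = 0")
    case False
    then have pi: "0 < p i" using p(1)[OF that] by simp
    have "ln (exp (y i - L) / p i) \<le> exp (y i - L) / p i - 1"
      using pi by (intro ln_le_minus_one) simp
    then have "y i - L - ln (p i) \<le> exp (y i - L) / p i - 1"
      using pi by (simp add: ln_div)
    then have "p i * (y i - L - ln (p i)) \<le> p i * (exp (y i - L) / p i - 1)"
      using pi by (intro mult_left_mono) auto
    then show ?thesis using pi by (simp add: right_diff_distrib)
  qed simp
  then have "(\<Sum>i\<in>A. p i * (y i - L - ln (p i))) \<le> (\<Sum>i\<in>A. exp (y i - L) - p i)"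
    by (rule sum_mono)
  also have "\<dots> = (\<Sum>i\<in>A. exp (y i)) / exp L - 1"
    by (simp add: sum_subtractf p(2) exp_diff sum_divide_distrib)
  also have "\<dots> = 0" using pos by (simp add: L_def)
  finally have "(\<Sum>i\<in>A. p i * (y i - L - ln (p i))) \<le> 0" .
  moreover have "(\<Sum>i\<in>A. p i * (y i - L - ln (p i)))
      = (\<Sum>i\<in>A. p i * y i) - (\<Sum>i\<in>A. p i) * L - (\<Sum>i\<in>A. p i * ln (p i))"
    unfolding sum_distrib_right sum_subtractf[symmetric] by (simp add: right_diff_distrib)
  ultimately show ?thesis by (simp add: p(2) L_def)
qed

text \<open>The optimal \<open>y = ln p\<close> of the variational principle is infinite where \<open>p\<close> vanishes. Replacing it by
  \<open>ln (p + e)\<close> loses only the normalisation \<open>ln (1 + card A * e)\<close>.\<close>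

lemma gibbs_ge:
  fixes p :: "'b \<Rightarrow> real"
  assumes A: "finite A" and p: "\<And>i. i \<in> A \<Longrightarrow> 0 \<le> p i" "(\<Sum>i\<in>A. p i) = 1" and e: "0 < e"
  shows "(\<Sum>i\<in>A. p i * ln (p i)) - real (card A) * e
    \<le> (\<Sum>i\<in>A. p i * ln (p i + e)) - ln (\<Sum>i\<in>A. p i + e)"
proof -
  have "p i * ln (p i) \<le> p i * ln (p i + e)" if "i \<in> A" for i
  proof (cases "p i = 0")
    case False
    with p(1)[OF that] have "0 < p i" by simp
    then show ?thesis using e by (intro mult_left_mono) auto
  qed simp
  then have "(\<Sum>i\<in>A. p i * ln (p i)) \<le> (\<Sum>i\<in>A. p i * ln (p i + e))" by (rule sum_mono)
  moreover have "(\<Sum>i\<in>A. p i + e) = 1 + real (card A) * e"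
    by (simp add: sum.distrib p(2))
  then have "ln (\<Sum>i\<in>A. p i + e) \<le> real (card A) * e"
    using e by (simp add: ln_add_one_self_le_self)
  ultimately show ?thesis by linarith
qed

section \<open>Zero set and domain of the rate function\<close>

lemma Lambda_star_ge: "ereal (s \<bullet> x - ln (psi lam s)) \<le> Lambda_star lam x"
  unfolding Lambda_star_def by (rule SUP_upper) simp

lemma Lambda_star_le:
  assumes "\<And>s. s \<bullet> x - ln (psi lam s) \<le> B"
  shows "Lambda_star lam x \<le> ereal B"
  unfolding Lambda_star_def by (rule SUP_least) (simp add: assms)

lemma psi_zero:
  assumes "0 \<le> lam" "lam < 1"
  shows "psi lam (0 :: real ^ 'n::finite) = 1"
  using assms by (simp add: psi_clip clip_nonneg add.commute)

lemma Lambda_star_nonneg: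
  assumes "0 \<le> lam" "lam < 1"
  shows "0 \<le> Lambda_star lam x"
  using Lambda_star_ge[of 0 x lam] by (simp add: psi_zero[OF assms] zero_ereal_def)

lemma Lambda_star_finiteD:
  assumes "0 \<le> lam" "lam < 1" "Lambda_star lam x < \<infinity>"
  obtains B where "0 \<le> B" "Lambda_star lam x = ereal B" "\<And>s. s \<bullet> x - ln (psi lam s) \<le> B"
proof -
  obtain B where B: "Lambda_star lam x = ereal B"
    using assms(3) Lambda_star_nonneg[OF assms(1,2), of x] by (cases "Lambda_star lam x") auto
  have "s \<bullet> x - ln (psi lam s) \<le> B" for s
    using Lambda_star_ge[of s x lam] B by simp
  moreover have "0 \<le> B" using Lambda_star_nonneg[OF assms(1,2), of x] B by simp
  ultimately show ?thesis using that B by blast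
qed

text \<open>The velocity of the walk away from the hyperplanes, which is the gradient of \<open>ln psi\<close> at \<open>0\<close>.\<close>

definition drift :: "real \<Rightarrow> real ^ 'n::finite" where
  "drift lam = (\<chi> i. (1 - lam) / (real CARD('n) * (1 + lam)))"

text \<open>Jensen's inequality for the exponential: \<open>psi\<close> is an average of exponentials with weights
  \<open>1 / (d * (1 + lam))\<close> and \<open>lam / (d * (1 + lam))\<close>, whose mean exponent is \<open>Y\<close>. Truncation only raises
  the exponents, and the drift has nonnegative coordinates.\<close>

lemma inner_drift_le:
  assumes lam: "0 \<le> lam" "lam < 1"
  shows "s \<bullet> (drift lam :: real ^ 'n::finite) \<le> ln (psi lam s)"
proof -
  define D where "D = real CARD('n) * (1 + lam)"
  define a where "a i = clip lam (s $ i)" for i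
  define Y where "Y = (\<Sum>i\<in>UNIV. a i) * (1 - lam) / D"
  have D: "0 < D" using lam by (simp add: D_def)
  have "s \<bullet> drift lam = (\<Sum>i\<in>UNIV. s $ i * ((1 - lam) / D))"
    by (simp add: inner_vec_def drift_def D_def)
  also have "\<dots> \<le> (\<Sum>i\<in>UNIV. a i * ((1 - lam) / D))"
    using lam D by (intro sum_mono mult_right_mono) (auto simp: a_def clip_def)
  also have "\<dots> = Y" by (simp add: Y_def sum_distrib_right sum_divide_distrib)
  also have "Y \<le> ln (psi lam s)"
  proof -
    have "D = (\<Sum>i\<in>UNIV. (1 + lam) + (1 - lam) * a i - (1 + lam) * Y)"
      using D by (simp add: sum.distrib sum_subtractf sum_distrib_left[symmetric] Y_def)
        (simp add: D_def field_simps)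
    also have "\<dots> \<le> (\<Sum>i\<in>UNIV. lam * exp (- a i - Y) + exp (a i - Y))"
    proof (rule sum_mono)
      fix i
      have "1 + (a i - Y) \<le> exp (a i - Y)" "lam * (1 + (- a i - Y)) \<le> lam * exp (- a i - Y)"
        using lam exp_ge_add_one_self[of "- a i - Y"] exp_ge_add_one_self[of "a i - Y"]
        by (auto intro: mult_left_mono)
      then show "(1 + lam) + (1 - lam) * a i - (1 + lam) * Y \<le> lam * exp (- a i - Y) + exp (a i - Y)"
        by (simp add: algebra_simps)
    qed
    also have "\<dots> = (\<Sum>i\<in>UNIV. lam * exp (- a i) + exp (a i)) / exp Y"
      by (simp add: exp_diff sum_divide_distrib add_divide_distrib)
    finally have "exp Y \<le> psi lam s"
      unfolding psi_clip[OF lam] using D by (simp add: a_def D_def field_simps)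
    then show ?thesis using psi_pos[OF lam, of s] by (simp add: ln_ge_iff)
  qed
  finally show ?thesis .
qed

lemma psi_axis:
  fixes j :: "'n::finite"
  assumes lam: "0 \<le> lam" "lam < 1"
  shows "psi lam (axis j t) = ((real CARD('n) - 1) * (1 + lam)
      + (lam * exp (- clip lam t) + exp (clip lam t))) / (real CARD('n) * (1 + lam))"
proof -
  let ?th = "\<lambda>i. lam * exp (- clip lam (axis j t $ i)) + exp (clip lam (axis j t $ i))"
  have "(\<Sum>i\<in>UNIV. ?th i) = ?th j + (\<Sum>i\<in>UNIV - {j}. ?th i)"
    by (rule sum.remove) auto
  also have "(\<Sum>i\<in>UNIV - {j}. ?th i) = (\<Sum>i\<in>UNIV - {j}. 1 + lam)"
    by (rule sum.cong) (auto simp: axis_component clip_nonneg[OF lam])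
  finally show ?thesis
    unfolding psi_clip[OF lam] by (simp add: axis_component of_nat_diff)
qed

text \<open>A zero \<open>x\<close> of the rate function is a subgradient of \<open>ln psi\<close> at \<open>0\<close>. Since \<open>0\<close> lies above the
  truncation level, \<open>psi\<close> is smooth there, and differentiating along each axis identifies \<open>x\<close>.\<close>

lemma Lambda_star_zero_iff:
  fixes x :: "real ^ 'n::finite"
  assumes lam: "0 \<le> lam" "lam < 1"
  shows "Lambda_star lam x = 0 \<longleftrightarrow> x = drift lam"
proof
  assume "x = drift lam"
  then have "Lambda_star lam x \<le> ereal 0"
    using inner_drift_le[OF lam] by (intro Lambda_star_le) simp
  then show "Lambda_star lam x = 0"
    using Lambda_star_nonneg[OF lam, of x] by (simp add: zero_ereal_def[symmetric])
next
  assume 0: "Lambda_star lam x = 0"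
  have "x $ j = drift lam $ j" for j
  proof -
    define K where "K = real CARD('n) * (1 + lam)"
    have K: "0 < K" unfolding K_def using lam by (intro mult_pos_pos) auto
    define g where "g t = ln ((K - (1 + lam) + (lam * exp (- t) + exp t)) / K) - t * x $ j" for t
    have "(g has_real_derivative ((1 - lam) / K - x $ j)) (at 0)"
      unfolding g_def
      by (rule derivative_eq_intros refl | use K in \<open>simp\<close>)+
    moreover obtain \<delta> :: real where \<delta>: "0 < \<delta>" "\<And>t. \<bar>t\<bar> < \<delta> \<Longrightarrow> clip lam t = t"
    proof (cases "lam = 0")
      case False
      then have "ln lam < 0" using lam by (intro ln_less_zero) auto
      then show ?thesis
        by (intro that[of "- ln lam / 2"]) (auto simp: clip_def max_def)
    qed (use that[of 1] in \<open>simp add: clip_def\<close>)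
    moreover have "g 0 \<le> g t" if "\<bar>0 - t\<bar> < \<delta>" for t
    proof -
      have "axis j t \<bullet> x - ln (psi lam (axis j t)) \<le> 0"
        using Lambda_star_ge[of "axis j t" x lam] 0 by simp
      moreover have "axis j t \<bullet> x = t * x $ j"
        by (simp add: inner_commute[of "axis j t"] inner_axis)
      ultimately have "0 \<le> g t"
        using \<delta>(2)[of t] that by (simp add: psi_axis[OF lam] g_def K_def left_diff_distrib)
      moreover have "g 0 = 0" using K by (simp add: g_def)
      ultimately show ?thesis by simp
    qed
    ultimately have "(1 - lam) / K - x $ j = 0"
      by (intro DERIV_local_min[of g _ 0 \<delta>]) auto
    then show ?thesis by (simp add: drift_def K_def)
  qed
  then show "x = drift lam" by (simp add: vec_eq_iff)
qed

lemma unbounded_slope: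
  fixes c B :: real
  assumes "\<And>t. 0 \<le> t \<Longrightarrow> t * c \<le> B"
  shows "c \<le> 0"
proof (rule ccontr)
  assume "\<not> c \<le> 0"
  then have c: "0 < c" by simp
  have "(\<bar>B\<bar> + 1) / c * c \<le> B" using c by (intro assms) simp
  then show False using c by simp
qed

lemma psi_le_2:
  fixes s :: "real ^ 'n::finite"
  assumes lam: "0 \<le> lam" "lam < 1" and s: "\<And>i. s $ i \<le> 0"
  shows "psi lam s \<le> 2"
proof -
  have "lam * exp (- clip lam (s $ i)) + exp (clip lam (s $ i)) \<le> 2 * (1 + lam)" for i
  proof (cases "lam = 0")
    case True
    then show ?thesis using s[of i] by (simp add: clip_def)
        (metis exp_le_one_iff linorder_le_cases order_trans one_le_numeral)
  next
    case False
    define a where "a = clip lam (s $ i)"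
    have l: "ln lam \<le> 0" using False lam by simp
    then have a: "a \<le> 0" "ln lam / 2 \<le> a" using s[of i] False by (auto simp: a_def clip_def)
    have "lam * exp (- a) = exp (ln lam - a)" using False lam by (simp add: exp_diff exp_minus field_simps)
    also have "\<dots> \<le> exp 0" using a l by (simp del: exp_zero)
    finally have "lam * exp (- a) \<le> 1" by simp
    moreover have "exp a \<le> 1" using a by simp
    ultimately have "lam * exp (- a) + exp a \<le> 1 + 1" by (rule add_mono)
    also have "\<dots> \<le> 2 * (1 + lam)" using lam by simp
    finally show ?thesis by (simp add: a_def)
  qed
  then have "(\<Sum>i\<in>UNIV. lam * exp (- clip lam (s $ i)) + exp (clip lam (s $ i)))
      \<le> (\<Sum>i\<in>(UNIV :: 'n set). 2 * (1 + lam))"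
    by (rule sum_mono)
  moreover have "0 < real CARD('n) * (1 + lam)" using lam by (intro mult_pos_pos) auto
  ultimately show ?thesis
    unfolding psi_clip[OF lam] by (simp only: pos_divide_le_eq) (simp add: algebra_simps)
qed

text \<open>A negative coordinate or a sum above \<open>1\<close> makes \<open>s \<bullet> x - ln (psi lam s)\<close> grow linearly, along a
  negative axis or along the diagonal respectively.\<close>

lemma Lambda_star_finite_subset:
  fixes x :: "real ^ 'n::finite"
  assumes lam: "0 \<le> lam" "lam < 1" and fin: "Lambda_star lam x < \<infinity>"
  shows "0 \<le> x $ i" "(\<Sum>i\<in>UNIV. x $ i) \<le> 1"
proof -
  from Lambda_star_finiteD[OF lam fin]
  obtain B where B: "\<And>s. s \<bullet> x - ln (psi lam s) \<le> B" by metis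
  have "t * (- x $ i) \<le> B + ln 2" if "0 \<le> t" for t
  proof -
    have "ln (psi lam (axis i (- t) :: real ^ 'n)) \<le> ln 2"
      using that by (intro ln_mono psi_pos psi_le_2 lam) (auto simp: axis_component)
    moreover have "axis i (- t) \<bullet> x = t * (- x $ i)"
      by (simp add: inner_commute[of "axis i (- t)"] inner_axis)
    ultimately show ?thesis using B[of "axis i (- t)"] by linarith
  qed
  then have "- x $ i \<le> 0" by (rule unbounded_slope)
  then show "0 \<le> x $ i" by simp
  have "t * ((\<Sum>i\<in>UNIV. x $ i) - 1) \<le> B" if "0 \<le> t" for t
  proof -
    have "ln (psi lam ((\<chi> i. t) :: real ^ 'n)) \<le> ln (exp t)"
      using that by (intro ln_mono psi_pos psi_diagonal_le lam) auto
    moreover have "((\<chi> i. t) :: real ^ 'n) \<bullet> x = t * (\<Sum>i\<in>UNIV. x $ i)"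
      by (simp add: inner_vec_def sum_distrib_left)
    ultimately show ?thesis using B[of "\<chi> i. t"] by (simp add: algebra_simps)
  qed
  then have "(\<Sum>i\<in>UNIV. x $ i) - 1 \<le> 0" by (rule unbounded_slope)
  then show "(\<Sum>i\<in>UNIV. x $ i) \<le> 1" by simp
qed

text \<open>For every \<open>i\<close>, both the clipped slope \<open>a i\<close> and \<open>0\<close> are at most \<open>ln (psi lam s) + B\<close>, and
  \<open>s \<bullet> x\<close> is dominated by a combination of these values with total weight at most \<open>1\<close>.
  Positivity of \<open>lam\<close> keeps \<open>psi\<close> away from \<open>0\<close>.\<close>

lemma Lambda_star_finite_pos:
  fixes x :: "real ^ 'n::finite"
  assumes lam: "0 < lam" "lam < 1" and x: "\<And>i. 0 \<le> x $ i" "(\<Sum>i\<in>UNIV. x $ i) \<le> 1"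
  shows "Lambda_star lam x < \<infinity>"
proof -
  have lam': "0 \<le> lam" using lam by simp
  define D where "D = real CARD('n) * (1 + lam)"
  define B where "B = max (ln D) (- ln (lam / D))"
  have D: "0 < D" using lam by (simp add: D_def)
  have "s \<bullet> x - ln (psi lam s) \<le> B" for s
  proof -
    define a where "a i = clip lam (s $ i)" for i
    define P where "P = ln (psi lam s)"
    have psi_ge: "(lam * exp (- a i) + exp (a i)) / D \<le> psi lam s" for i
    proof -
      have "lam * exp (- a i) + exp (a i) \<le> (\<Sum>i\<in>UNIV. lam * exp (- a i) + exp (a i))"
        using lam by (intro member_le_sum) auto
      then show ?thesis
        unfolding psi_clip[OF lam' lam(2)] a_def D_def using lam by (intro divide_right_mono) auto
    qed
    have a_le: "a i \<le> P + B" for i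
    proof -
      have "exp (a i) / D \<le> (lam * exp (- a i) + exp (a i)) / D"
        using lam D by (intro divide_right_mono) auto
      also have "\<dots> \<le> psi lam s" by (rule psi_ge)
      finally have "ln (exp (a i) / D) \<le> P" unfolding P_def using D by (intro ln_mono) auto
      then show ?thesis using D by (simp add: ln_div B_def)
    qed
    have PB: "0 \<le> P + B"
    proof -
      fix i :: 'n
      have "lam \<le> lam * exp (- a i) + exp (a i)"
      proof (cases "0 \<le> a i")
        case True
        then have "lam \<le> exp (a i)" using lam by (smt (verit) one_le_exp_iff)
        then show ?thesis using lam by (simp add: add_increasing)
      next
        case False
        then have "lam * 1 \<le> lam * exp (- a i)" using lam by (intro mult_left_mono) auto
        then show ?thesis by (simp add: add_increasing2)
      qed
      then have "lam / D \<le> (lam * exp (- a i) + exp (a i)) / D"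
        using D by (intro divide_right_mono) auto
      also have "\<dots> \<le> psi lam s" by (rule psi_ge)
      finally have "ln (lam / D) \<le> P" unfolding P_def using D lam by (intro ln_mono) auto
      then show ?thesis by (simp add: B_def)
    qed
    have "s \<bullet> x = (\<Sum>i\<in>UNIV. s $ i * x $ i)" by (simp add: inner_vec_def)
    also have "\<dots> \<le> (\<Sum>i\<in>UNIV. (P + B) * x $ i)"
    proof (intro sum_mono mult_right_mono x)
      fix i
      have "s $ i \<le> a i" by (simp add: a_def clip_def)
      with a_le[of i] show "s $ i \<le> P + B" by linarith
    qed
    also have "\<dots> = (P + B) * (\<Sum>i\<in>UNIV. x $ i)" by (simp add: sum_distrib_left)
    also have "\<dots> \<le> (P + B) * 1" using PB x by (intro mult_left_mono)
    finally show ?thesis by (simp add: P_def)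
  qed
  then have "Lambda_star lam x \<le> ereal B" by (rule Lambda_star_le)
  then show ?thesis by (rule order_le_less_trans) simp
qed

section \<open>The rate function without downward steps\<close>

lemma psi_lam_0: "psi 0 (s :: real ^ 'n::finite) = (\<Sum>i\<in>UNIV. exp (s $ i)) / real CARD('n)"
  by (simp add: psi_clip clip_def)

text \<open>Without downward steps, every step raises the sum of the absolute values by exactly \<open>1\<close>, and
  accordingly slopes along the negative diagonal exclude sums below \<open>1\<close> as well.\<close>

lemma Lambda_star_0_finite_sum:
  fixes x :: "real ^ 'n::finite"
  assumes fin: "Lambda_star 0 x < \<infinity>"
  shows "(\<Sum>i\<in>UNIV. x $ i) = 1"
proof -
  have lam: "0 \<le> (0 :: real)" "(0 :: real) < 1" by auto
  from Lambda_star_finiteD[OF lam fin]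
  obtain B where B: "\<And>s. s \<bullet> x - ln (psi 0 s) \<le> B" by metis
  have "t * (1 - (\<Sum>i\<in>UNIV. x $ i)) \<le> B" if "0 \<le> t" for t
  proof -
    have "ln (psi 0 ((\<chi> i. - t) :: real ^ 'n)) = - t" by (simp add: psi_lam_0)
    moreover have "((\<chi> i. - t) :: real ^ 'n) \<bullet> x = - t * (\<Sum>i\<in>UNIV. x $ i)"
      by (simp add: inner_vec_def sum_distrib_left sum_negf)
    ultimately show ?thesis using B[of "\<chi> i. - t"] by (simp add: algebra_simps)
  qed
  then have "1 - (\<Sum>i\<in>UNIV. x $ i) \<le> 0" by (rule unbounded_slope)
  then show ?thesis using Lambda_star_finite_subset(2)[OF lam fin] by simp
qed

lemma Lambda_star_0:
  fixes x :: "real ^ 'n::finite"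
  assumes x: "\<And>i. 0 \<le> x $ i" "(\<Sum>i\<in>UNIV. x $ i) = 1"
  shows "Lambda_star 0 x = ereal (ln (real CARD('n)) + (\<Sum>i\<in>UNIV. x $ i * ln (x $ i)))"
proof (rule antisym)
  let ?d = "real CARD('n)"
  have ln_psi: "ln (psi 0 s) = ln (\<Sum>i\<in>UNIV. exp (s $ i)) - ln ?d" for s :: "real ^ 'n"
    unfolding psi_lam_0 by (rule ln_divide_pos) (auto intro: sum_pos)
  show "Lambda_star 0 x \<le> ereal (ln ?d + (\<Sum>i\<in>UNIV. x $ i * ln (x $ i)))"
  proof (rule Lambda_star_le)
    fix s :: "real ^ 'n"
    have "(\<Sum>i\<in>UNIV. x $ i * s $ i) - ln (\<Sum>i\<in>UNIV. exp (s $ i)) \<le> (\<Sum>i\<in>UNIV. x $ i * ln (x $ i))"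
      by (rule gibbs_le) (use x in auto)
    then show "s \<bullet> x - ln (psi 0 s) \<le> ln ?d + (\<Sum>i\<in>UNIV. x $ i * ln (x $ i))"
      unfolding ln_psi by (simp add: inner_vec_def mult.commute)
  qed
  show "ereal (ln ?d + (\<Sum>i\<in>UNIV. x $ i * ln (x $ i))) \<le> Lambda_star 0 x"
  proof (rule ereal_le_epsilon2)
    fix \<epsilon> :: real assume \<epsilon>: "0 < \<epsilon>"
    define e where "e = \<epsilon> / ?d"
    have e: "0 < e" using \<epsilon> by (simp add: e_def)
    define s :: "real ^ 'n" where "s = (\<chi> i. ln (x $ i + e))"
    have exp_s: "exp (s $ i) = x $ i + e" for i using x(1)[of i] e by (simp add: s_def)
    have "(\<Sum>i\<in>UNIV. x $ i * ln (x $ i)) - real (card (UNIV :: 'n set)) * e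
        \<le> (\<Sum>i\<in>UNIV. x $ i * ln (x $ i + e)) - ln (\<Sum>i\<in>UNIV. x $ i + e)"
      by (rule gibbs_ge) (use x e in auto)
    then have "ln ?d + (\<Sum>i\<in>UNIV. x $ i * ln (x $ i)) \<le> s \<bullet> x - ln (psi 0 s) + \<epsilon>"
      unfolding ln_psi exp_s by (simp add: inner_vec_def s_def e_def mult.commute)
    then have "ereal (ln ?d + (\<Sum>i\<in>UNIV. x $ i * ln (x $ i))) \<le> ereal (s \<bullet> x - ln (psi 0 s)) + ereal \<epsilon>"
      by simp
    also have "\<dots> \<le> Lambda_star 0 x + ereal \<epsilon>" by (intro add_right_mono Lambda_star_ge)
    finally show "ereal (ln ?d + (\<Sum>i\<in>UNIV. x $ i * ln (x $ i))) \<le> Lambda_star 0 x + ereal \<epsilon>" .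
  qed
qed

section \<open>Reduction to the symmetric walk\<close>

lemma psi_cosh:
  fixes s :: "real ^ 'n::finite"
  assumes lam: "0 < lam" "lam < 1"
  shows "psi lam s = rho lam * ((\<Sum>i\<in>UNIV. cosh (max (s $ i - ln lam / 2) 0)) / real CARD('n))"
proof -
  have q: "exp (ln lam / 2) = sqrt lam" using lam by (simp add: ln_sqrt[symmetric])
  have "lam * exp (- clip lam (s $ i)) + exp (clip lam (s $ i))
      = 2 * sqrt lam * cosh (max (s $ i - ln lam / 2) 0)" for i
  proof -
    define u where "u = max (s $ i - ln lam / 2) 0"
    have c: "clip lam (s $ i) = ln lam / 2 + u" using lam by (simp add: clip_def u_def max_def)
    have "lam * exp (- (ln lam / 2 + u)) = lam * (inverse (sqrt lam) * exp (- u))"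
      by (simp only: minus_add_distrib exp_add exp_minus[of "ln lam / 2"] q)
    also have "\<dots> = sqrt lam * exp (- u)"
      using lam by (simp add: mult.assoc[symmetric] divide_inverse[symmetric] real_div_sqrt)
    finally have minus: "lam * exp (- (ln lam / 2 + u)) = sqrt lam * exp (- u)" .
    have plus: "exp (ln lam / 2 + u) = sqrt lam * exp u" by (simp only: exp_add q)
    show ?thesis unfolding c u_def[symmetric] minus plus
      by (simp add: cosh_field_def algebra_simps)
  qed
  then have "psi lam s = (\<Sum>i\<in>UNIV. 2 * sqrt lam * cosh (max (s $ i - ln lam / 2) 0))
      / (real CARD('n) * (1 + lam))"
    using psi_clip[of lam s] lam by simp
  then show ?thesis unfolding sum_distrib_left[symmetric] rho_def by (simp add: mult.commute)
qed

lemma rho_pos: "0 < lam \<Longrightarrow> 0 < rho lam"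
  by (simp add: rho_def)

lemma ln_psi_cosh:
  fixes s :: "real ^ 'n::finite"
  assumes lam: "0 < lam" "lam < 1"
  shows "ln (psi lam s) = ln (rho lam) + ln ((\<Sum>i\<in>UNIV. cosh (max (s $ i - ln lam / 2) 0)) / real CARD('n))"
  unfolding psi_cosh[OF lam] using rho_pos[OF lam(1)]
  by (intro ln_mult_pos divide_pos_pos sum_pos) auto

text \<open>Slopes below the truncation level can be raised to it: this leaves \<open>psi\<close> unchanged and increases
  \<open>s \<bullet> x\<close> when \<open>x\<close> has nonnegative coordinates.\<close>

lemma Lambda_star_le_centred:
  fixes x :: "real ^ 'n::finite"
  assumes lam: "0 < lam" "lam < 1" and x: "\<And>i. 0 \<le> x $ i"
    and B: "\<And>t. t \<bullet> x - ln ((\<Sum>i\<in>UNIV. cosh (t $ i)) / real CARD('n)) \<le> B"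
  shows "Lambda_star lam x \<le> ereal ((\<Sum>i\<in>UNIV. x $ i) / 2 * ln lam - ln (rho lam) + B)"
proof (rule Lambda_star_le)
  fix s :: "real ^ 'n"
  define t :: "real ^ 'n" where "t = (\<chi> i. max (s $ i - ln lam / 2) 0)"
  have "s \<bullet> x \<le> (\<Sum>i\<in>UNIV. (ln lam / 2 + t $ i) * x $ i)"
    unfolding inner_vec_def inner_real_def using x by (intro sum_mono mult_right_mono) (auto simp: t_def)
  also have "\<dots> = (\<Sum>i\<in>UNIV. x $ i) / 2 * ln lam + t \<bullet> x"
    by (simp add: inner_vec_def distrib_right sum.distrib sum_distrib_left[symmetric]
        sum_divide_distrib[symmetric])
  finally show "s \<bullet> x - ln (psi lam s) \<le> (\<Sum>i\<in>UNIV. x $ i) / 2 * ln lam - ln (rho lam) + B"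
    using B[of t] unfolding ln_psi_cosh[OF lam] by (simp add: t_def)
qed

text \<open>Since \<open>cosh\<close> is even and \<open>x\<close> has nonnegative coordinates, \<open>t\<close> may be replaced by its absolute
  values, which lie above the truncation level.\<close>

lemma Lambda_star_ge_centred:
  fixes x t :: "real ^ 'n::finite"
  assumes lam: "0 < lam" "lam < 1" and x: "\<And>i. 0 \<le> x $ i"
  shows "ereal ((\<Sum>i\<in>UNIV. x $ i) / 2 * ln lam - ln (rho lam)
    + (t \<bullet> x - ln ((\<Sum>i\<in>UNIV. cosh (t $ i)) / real CARD('n)))) \<le> Lambda_star lam x"
proof -
  define s :: "real ^ 'n" where "s = (\<chi> i. ln lam / 2 + \<bar>t $ i\<bar>)"
  have "(\<Sum>i\<in>UNIV. x $ i) / 2 * ln lam + t \<bullet> x = (\<Sum>i\<in>UNIV. (ln lam / 2 + t $ i) * x $ i)"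
    by (simp add: inner_vec_def distrib_right sum.distrib sum_distrib_left[symmetric]
        sum_divide_distrib[symmetric])
  also have "\<dots> \<le> s \<bullet> x"
    unfolding inner_vec_def inner_real_def using x by (intro sum_mono mult_right_mono) (auto simp: s_def)
  finally have "(\<Sum>i\<in>UNIV. x $ i) / 2 * ln lam + t \<bullet> x \<le> s \<bullet> x" .
  moreover have "ln (psi lam s) = ln (rho lam) + ln ((\<Sum>i\<in>UNIV. cosh (t $ i)) / real CARD('n))"
    unfolding ln_psi_cosh[OF lam] by (simp add: s_def)
  ultimately have "(\<Sum>i\<in>UNIV. x $ i) / 2 * ln lam - ln (rho lam)
    + (t \<bullet> x - ln ((\<Sum>i\<in>UNIV. cosh (t $ i)) / real CARD('n))) \<le> s \<bullet> x - ln (psi lam s)"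
    by linarith
  then show ?thesis
    using Lambda_star_ge[of s x lam] by (meson ereal_less_eq(3) order_trans)
qed

section \<open>Drifts of tilted walks\<close>

lemma cosh_ge_abs: "\<bar>u\<bar> - ln 2 \<le> ln (cosh (u :: real))"
proof -
  have "exp \<bar>u\<bar> / 2 \<le> cosh u" by (auto simp: cosh_field_def abs_if)
  then have "ln (exp \<bar>u\<bar> / 2) \<le> ln (cosh u)" by (intro ln_mono) auto
  then show ?thesis by (simp add: ln_div)
qed

text \<open>The function \<open>t \<bullet> x - ln (\<Sum>j. cosh (t $ j))\<close> tends to minus infinity, because the logarithm grows
  like the largest \<open>\<bar>t $ j\<bar>\<close> while \<open>t \<bullet> x\<close> grows at most like a multiple below \<open>1\<close> of it. The equations
  say that its gradient vanishes at a maximum.\<close>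

lemma centred_maximiser:
  fixes x :: "real ^ 'n::finite"
  assumes x: "\<And>i. 0 < x $ i" "(\<Sum>i\<in>UNIV. x $ i) < 1"
  obtains t :: "real ^ 'n" where "\<And>i. x $ i * (\<Sum>j\<in>UNIV. cosh (t $ j)) = sinh (t $ i)"
proof -
  define d where "d = real CARD('n)"
  have d: "0 < d" by (simp add: d_def)
  define f where "f t = t \<bullet> x - ln (\<Sum>j\<in>UNIV. cosh (t $ j))" for t :: "real ^ 'n"
  have cosh_sum_pos: "0 < (\<Sum>j\<in>UNIV. cosh (t $ j))" for t :: "real ^ 'n"
    by (intro sum_pos) auto
  \<comment> \<open>beyond norm \<open>R\<close> the largest \<open>\<bar>t $ j\<bar>\<close>, at least \<open>norm t / d\<close>, forces a value below the value \<open>- ln d\<close> at \<open>0\<close>\<close>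
  define R where "R = (ln 2 + ln d) * d / (1 - (\<Sum>i\<in>UNIV. x $ i)) + 1"
  have far: "f t < f 0" if t: "R \<le> norm t" for t
  proof -
    have "Max (range (\<lambda>i. \<bar>t $ i\<bar>)) \<in> range (\<lambda>i. \<bar>t $ i\<bar>)" by (rule Max_in) auto
    then obtain j where j_max: "Max (range (\<lambda>i. \<bar>t $ i\<bar>)) = \<bar>t $ j\<bar>" by (elim imageE)
    have j: "\<bar>t $ i\<bar> \<le> \<bar>t $ j\<bar>" for i
      unfolding j_max[symmetric] by (rule Max_ge) auto
    have "t \<bullet> x \<le> (\<Sum>i\<in>UNIV. \<bar>t $ j\<bar> * x $ i)"
      unfolding inner_vec_def inner_real_def
    proof (intro sum_mono mult_right_mono)
      fix i show "t $ i \<le> \<bar>t $ j\<bar>" using j[of i] by linarith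
      show "0 \<le> x $ i" using x(1)[of i] by simp
    qed
    also have "\<dots> = \<bar>t $ j\<bar> * (\<Sum>i\<in>UNIV. x $ i)" by (simp add: sum_distrib_left)
    finally have 1: "t \<bullet> x \<le> \<bar>t $ j\<bar> * (\<Sum>i\<in>UNIV. x $ i)" .
    have "cosh (t $ j) \<le> (\<Sum>j\<in>UNIV. cosh (t $ j))"
      by (intro member_le_sum) auto
    then have "ln (cosh (t $ j)) \<le> ln (\<Sum>j\<in>UNIV. cosh (t $ j))" by (intro ln_mono) auto
    then have 2: "\<bar>t $ j\<bar> - ln 2 \<le> ln (\<Sum>j\<in>UNIV. cosh (t $ j))"
      using cosh_ge_abs[of "t $ j"] by linarith
    have "norm t \<le> (\<Sum>i\<in>UNIV. \<bar>t $ i\<bar>)" by (rule norm_le_l1_cart)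
    also have "\<dots> \<le> (\<Sum>i\<in>(UNIV :: 'n set). \<bar>t $ j\<bar>)" using j by (intro sum_mono)
    finally have "norm t \<le> d * \<bar>t $ j\<bar>" by (simp add: d_def)
    with t have "(ln 2 + ln d) * d / (1 - (\<Sum>i\<in>UNIV. x $ i)) < d * \<bar>t $ j\<bar>" by (simp add: R_def)
    then have "(ln 2 + ln d) * d < d * \<bar>t $ j\<bar> * (1 - (\<Sum>i\<in>UNIV. x $ i))"
      using x(2) by (simp add: pos_divide_less_eq)
    then have "d * (ln 2 + ln d) < d * (\<bar>t $ j\<bar> * (1 - (\<Sum>i\<in>UNIV. x $ i)))"
      by (simp add: mult_ac)
    then have "ln 2 + ln d < \<bar>t $ j\<bar> * (1 - (\<Sum>i\<in>UNIV. x $ i))"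
      using d by (simp only: mult_less_cancel_left_pos)
    then show ?thesis using 1 2 by (simp add: f_def d_def right_diff_distrib)
  qed
  have cont: "continuous_on (cball 0 \<bar>R\<bar>) f"
    unfolding f_def using cosh_sum_pos by (intro continuous_intros) (auto simp: less_imp_neq[symmetric])
  obtain t where t: "t \<in> cball 0 \<bar>R\<bar>" "\<And>u. u \<in> cball 0 \<bar>R\<bar> \<Longrightarrow> f u \<le> f t"
    using continuous_attains_sup[OF compact_cball _ cont] by auto
  have max: "f u \<le> f t" for u
  proof (cases "u \<in> cball 0 \<bar>R\<bar>")
    case False
    then have "f u < f 0" by (intro far) auto
    also have "f 0 \<le> f t" by (rule t(2)) simp
    finally show ?thesis by simp
  qed (rule t(2))
  have "x $ i * (\<Sum>j\<in>UNIV. cosh (t $ j)) = sinh (t $ i)" for i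
  proof -
    define C where "C = (\<Sum>j\<in>UNIV - {i}. cosh (t $ j))"
    define g where "g \<tau> = t \<bullet> x + \<tau> * x $ i - ln (cosh (t $ i + \<tau>) + C)" for \<tau>
    have C: "(\<Sum>j\<in>UNIV. cosh (t $ j)) = cosh (t $ i) + C"
      unfolding C_def by (rule sum.remove) auto
    have fg: "f (t + axis i \<tau>) = g \<tau>" for \<tau>
    proof -
      have "(\<Sum>j\<in>UNIV. cosh ((t + axis i \<tau>) $ j))
          = cosh ((t + axis i \<tau>) $ i) + (\<Sum>j\<in>UNIV - {i}. cosh ((t + axis i \<tau>) $ j))"
        by (rule sum.remove) auto
      also have "(\<Sum>j\<in>UNIV - {i}. cosh ((t + axis i \<tau>) $ j)) = C"
        unfolding C_def by (rule sum.cong) (auto simp: axis_component)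
      finally have "(\<Sum>j\<in>UNIV. cosh ((t + axis i \<tau>) $ j)) = cosh (t $ i + \<tau>) + C"
        by (simp add: axis_component)
      moreover have "(t + axis i \<tau>) \<bullet> x = t \<bullet> x + \<tau> * x $ i"
        by (simp add: inner_left_distrib inner_commute[of "axis i \<tau>"] inner_axis)
      ultimately show ?thesis by (simp add: f_def g_def)
    qed
    have pos: "0 < cosh (t $ i) + C" using cosh_sum_pos[of t] C by simp
    have "(g has_real_derivative (x $ i - sinh (t $ i) / (cosh (t $ i) + C))) (at 0)"
      unfolding g_def
      by (rule derivative_eq_intros refl | use pos in \<open>simp\<close>)+
    moreover have "g \<tau> \<le> g 0" for \<tau>
    proof -
      have shift_0: "axis i (0 :: real) = 0" by (simp add: vec_eq_iff axis_component)
      have "g 0 = f t" using fg[of 0] unfolding shift_0 by simp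
      then show ?thesis using max[of "t + axis i \<tau>"] fg[of \<tau>] by simp
    qed
    ultimately have "x $ i - sinh (t $ i) / (cosh (t $ i) + C) = 0"
      by (intro DERIV_local_max[of g _ 0 1]) auto
    then show ?thesis using pos unfolding C by (simp add: field_simps)
  qed
  then show ?thesis using that by blast
qed

text \<open>For positive \<open>lam\<close> the maximiser for the symmetric walk has positive coordinates, as its \<open>sinh\<close>
  values are positive, so it stays above the truncation level when shifted by \<open>ln lam / 2\<close>. For
  \<open>lam = 0\<close> the tilt is explicit.\<close>

lemma tilt_exists:
  fixes x :: "real ^ 'n::finite"
  assumes lam: "0 \<le> lam" "lam < 1" and x: "\<And>i. 0 < x $ i"
    and sum: "if lam = 0 then (\<Sum>i\<in>UNIV. x $ i) = 1 else (\<Sum>i\<in>UNIV. x $ i) < 1"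
  obtains s :: "real ^ 'n" where "\<And>i. clip lam (s $ i) = s $ i"
    "\<And>i. x $ i = (exp (s $ i) - lam * exp (- (s $ i))) / (real CARD('n) * (1 + lam) * psi lam s)"
proof (cases "lam = 0")
  case True
  show ?thesis
  proof (rule that[of "\<chi> i. ln (x $ i)"])
    show "clip lam ((\<chi> i. ln (x $ i)) $ i) = (\<chi> i. ln (x $ i)) $ i" for i
      using True by (simp add: clip_def)
    have "real CARD('n) * psi 0 ((\<chi> i. ln (x $ i)) :: real ^ 'n) = 1"
      using sum True x by (simp add: psi_lam_0)
    then show "x $ i = (exp ((\<chi> i. ln (x $ i)) $ i) - lam * exp (- ((\<chi> i. ln (x $ i)) $ i)))
        / (real CARD('n) * (1 + lam) * psi lam (\<chi> i. ln (x $ i)))" for i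
      using True x by simp
  qed
next
  case False
  then have lam0: "0 < lam" using lam by simp
  obtain t :: "real ^ 'n" where t: "\<And>i. x $ i * (\<Sum>j\<in>UNIV. cosh (t $ j)) = sinh (t $ i)"
    using centred_maximiser[of x] x sum False by auto
  have Z: "0 < (\<Sum>j\<in>UNIV. cosh (t $ j))" by (intro sum_pos) auto
  have t_pos: "0 < t $ i" for i
    using t[of i] x[of i] Z by (metis mult_pos_pos sinh_real_pos_iff)
  define s :: "real ^ 'n" where "s = (\<chi> i. ln lam / 2 + t $ i)"
  have q: "exp (ln lam / 2) = sqrt lam" using lam0 by (simp add: ln_sqrt[symmetric])
  show ?thesis
  proof (rule that[of s])
    show "clip lam (s $ i) = s $ i" for i
      using False t_pos[of i] by (simp add: clip_def s_def)
    have psi: "psi lam s = rho lam * ((\<Sum>j\<in>UNIV. cosh (t $ j)) / real CARD('n))"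
      using t_pos by (simp add: psi_cosh[OF lam0 lam(2)] s_def max_absorb1 less_imp_le)
    have den: "real CARD('n) * (1 + lam) * psi lam s = 2 * sqrt lam * (\<Sum>j\<in>UNIV. cosh (t $ j))"
    proof -
      have "d * k * (a / k * (S / d)) = a * S" if "d \<noteq> 0" "k \<noteq> 0" for d k a S :: real
        using that by simp
      then show ?thesis unfolding psi rho_def using lam0 by simp
    qed
    fix i
    have "exp (s $ i) = sqrt lam * exp (t $ i)" by (simp only: s_def vec_lambda_beta exp_add q)
    moreover have "lam * exp (- (s $ i)) = sqrt lam * exp (- (t $ i))"
    proof -
      have "lam * exp (- (s $ i)) = lam * (inverse (sqrt lam) * exp (- (t $ i)))"
        by (simp only: s_def vec_lambda_beta minus_add_distrib exp_add exp_minus[of "ln lam / 2"] q)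
      also have "\<dots> = sqrt lam * exp (- (t $ i))"
        using lam0 by (simp add: mult.assoc[symmetric] divide_inverse[symmetric] real_div_sqrt)
      finally show ?thesis .
    qed
    ultimately have num: "exp (s $ i) - lam * exp (- (s $ i)) = 2 * sqrt lam * sinh (t $ i)"
      by (simp add: sinh_field_def algebra_simps)
    show "x $ i = (exp (s $ i) - lam * exp (- (s $ i))) / (real CARD('n) * (1 + lam) * psi lam s)"
      unfolding den num t[of i, symmetric] using lam0 Z by simp
  qed
qed

text \<open>Convexity of the rate function together with its value \<open>0\<close> at \<open>drift lam\<close>.\<close>

lemma Lambda_star_convex_drift:
  fixes x :: "real ^ 'n::finite"
  assumes lam: "0 \<le> lam" "lam < 1" and e: "0 \<le> e" "e \<le> 1" and fin: "Lambda_star lam x < \<infinity>"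
  shows "Lambda_star lam ((1 - e) *\<^sub>R x + e *\<^sub>R drift lam) \<le> Lambda_star lam x"
proof -
  from Lambda_star_finiteD[OF lam fin]
  obtain B where B: "0 \<le> B" "Lambda_star lam x = ereal B" "\<And>s. s \<bullet> x - ln (psi lam s) \<le> B" by metis
  have "s \<bullet> ((1 - e) *\<^sub>R x + e *\<^sub>R drift lam) - ln (psi lam s) \<le> B" for s
  proof -
    have "s \<bullet> ((1 - e) *\<^sub>R x + e *\<^sub>R drift lam) - ln (psi lam s)
        = (1 - e) * (s \<bullet> x - ln (psi lam s)) + e * (s \<bullet> drift lam - ln (psi lam s))"
      by (simp add: inner_right_distrib algebra_simps)
    also have "\<dots> \<le> (1 - e) * B + e * 0"
      using e B(3)[of s] inner_drift_le[OF lam, of s] by (intro add_mono mult_left_mono) auto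
    also have "\<dots> \<le> B" using e B(1) by (simp add: algebra_simps)
    finally show ?thesis .
  qed
  then show ?thesis unfolding B(2) by (rule Lambda_star_le)
qed

section \<open>The large deviation principle\<close>

lemma good_rate_function_Lambda_star:
  assumes lam: "0 \<le> lam" "lam < 1"
  shows "good_rate_function (Lambda_star lam :: real ^ 'n::finite \<Rightarrow> ereal)"
  unfolding good_rate_function_def
proof (intro conjI allI)
  show "0 \<le> Lambda_star lam x" for x :: "real ^ 'n" by (rule Lambda_star_nonneg[OF lam])
  fix a :: real
  have eq: "{x :: real ^ 'n. Lambda_star lam x \<le> ereal a} = (\<Inter>s. {x. s \<bullet> x - ln (psi lam s) \<le> a})"
    unfolding Lambda_star_def by (auto simp: SUP_le_iff)
  have "closed {x :: real ^ 'n. Lambda_star lam x \<le> ereal a}"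
    unfolding eq by (intro closed_INT ballI closed_Collect_le continuous_intros)
  moreover have "{x :: real ^ 'n. Lambda_star lam x \<le> ereal a} \<subseteq> cbox 0 (\<chi> i. 1)"
  proof
    fix x :: "real ^ 'n" assume "x \<in> {x. Lambda_star lam x \<le> ereal a}"
    then have fin: "Lambda_star lam x < \<infinity>" by (auto intro: order_le_less_trans)
    have nonneg: "0 \<le> x $ i" for i by (rule Lambda_star_finite_subset(1)[OF lam fin])
    have "x $ i \<le> 1" for i
    proof -
      have "x $ i \<le> (\<Sum>i\<in>UNIV. x $ i)" using nonneg by (intro member_le_sum) auto
      also have "\<dots> \<le> 1" by (rule Lambda_star_finite_subset(2)[OF lam fin])
      finally show ?thesis .
    qed
    then show "x \<in> cbox 0 (\<chi> i. 1)" using nonneg by (simp add: mem_box_cart)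
  qed
  then have "bounded {x :: real ^ 'n. Lambda_star lam x \<le> ereal a}"
    by (rule bounded_subset[OF bounded_cbox])
  ultimately show "compact {x :: real ^ 'n. Lambda_star lam x \<le> ereal a}"
    by (simp add: compact_eq_bounded_closed)
qed

context folded_walk
begin

text \<open>Points with a vanishing coordinate, and for positive \<open>lam\<close> those with sum \<open>1\<close>, are outside the scope
  of \<open>tilt_exists\<close>. Moving a point of the domain slightly towards \<open>drift lam\<close> makes all coordinates positive and, for positive \<open>lam\<close>, the sum smaller than \<open>1\<close>, does not
  leave the open set and does not increase the rate.\<close>

lemma liminf_open_ge_Lambda_star:
  fixes G :: "(real ^ 'n) set"
  assumes G: "open G"
  shows "- (INF x\<in>G. Lambda_star lam x)
    \<le> liminf (\<lambda>n. ereal (1 / real n) * ext_ln (prob {\<omega> \<in> space M. scaled n (W n \<omega>) \<in> G}))"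
    (is "_ \<le> ?L")
proof -
  have "- ?L \<le> Lambda_star lam x" if x: "x \<in> G" for x
  proof (cases "Lambda_star lam x < \<infinity>")
    case True
    let ?y = "\<lambda>e. (1 - e) *\<^sub>R x + e *\<^sub>R drift lam"
    have "(?y \<longlongrightarrow> (1 - 0) *\<^sub>R x + 0 *\<^sub>R drift lam) (at_right 0)"
      by (intro tendsto_intros)
    then have "\<forall>\<^sub>F e in at_right 0. ?y e \<in> G"
      using G x by (auto dest!: topological_tendstoD)
    moreover have "\<forall>\<^sub>F e in at_right 0. e \<in> {0<..<1 :: real}"
      by (rule eventually_at_rightI[of 0 1]) auto
    ultimately obtain e where e: "?y e \<in> G" "0 < e" "e < 1"
      using eventually_happens'[OF trivial_limit_at_right_real eventually_conj] by force
    have drift_pos: "0 < drift lam $ i" for i :: 'n using lam by (simp add: drift_def)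
    have nonneg: "0 \<le> x $ i" for i by (rule Lambda_star_finite_subset(1)[OF lam True])
    have pos: "0 < ?y e $ i" for i
      using e nonneg[of i] drift_pos[of i] by (simp add: add_nonneg_pos)
    have drift_sum: "(\<Sum>i\<in>UNIV. (drift lam :: real ^ 'n) $ i) = (1 - lam) / (1 + lam)"
      by (simp add: drift_def)
    have y_sum: "(\<Sum>i\<in>UNIV. ?y e $ i) = (1 - e) * (\<Sum>i\<in>UNIV. x $ i) + e * ((1 - lam) / (1 + lam))"
      unfolding drift_sum[symmetric] by (simp add: sum.distrib sum_distrib_left)
    have "if lam = 0 then (\<Sum>i\<in>UNIV. ?y e $ i) = 1 else (\<Sum>i\<in>UNIV. ?y e $ i) < 1"
    proof (cases "lam = 0")
      case l: True
      then have "(\<Sum>i\<in>UNIV. x $ i) = 1" using Lambda_star_0_finite_sum[of x] True by simp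
      then show ?thesis unfolding y_sum using l by simp
    next
      case False
      have "(1 - e) * (\<Sum>i\<in>UNIV. x $ i) \<le> (1 - e) * 1"
        using e Lambda_star_finite_subset(2)[OF lam True] by (intro mult_left_mono) auto
      moreover have "e * ((1 - lam) / (1 + lam)) < e * 1"
        using e False lam by (intro mult_strict_left_mono) (auto simp: field_simps)
      ultimately show ?thesis unfolding y_sum using False by simp
    qed
    from tilt_exists[OF lam pos this] obtain s :: "real ^ 'n" where s: "\<And>i. clip lam (s $ i) = s $ i"
      "\<And>i. ?y e $ i = (exp (s $ i) - lam * exp (- (s $ i))) / (real CARD('n) * (1 + lam) * psi lam s)"
      by metis
    have "ereal (ln (psi lam s) - s \<bullet> ?y e) \<le> ?L"
      by (rule liminf_open_ge[OF s pos G e(1)])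
    then have "- ?L \<le> - ereal (ln (psi lam s) - s \<bullet> ?y e)" by (simp only: ereal_minus_le_minus)
    also have "\<dots> = ereal (s \<bullet> ?y e - ln (psi lam s))" by simp
    also have "\<dots> \<le> Lambda_star lam (?y e)" by (rule Lambda_star_ge)
    also have "\<dots> \<le> Lambda_star lam x" using e by (intro Lambda_star_convex_drift lam True) auto
    finally show ?thesis .
  qed simp
  then have "- ?L \<le> (INF x\<in>G. Lambda_star lam x)" by (intro INF_greatest)
  then have "- (INF x\<in>G. Lambda_star lam x) \<le> - (- ?L)" by (simp only: ereal_minus_le_minus)
  then show ?thesis by simp
qed

end

lemma scaled_abs_eq: "scaled_abs n v = scaled n (abs_coords v)"
  by (simp add: scaled_abs_def scaled_def abs_coords_def)

lemma biased_rw_LDP: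
  fixes X :: "nat \<Rightarrow> 'a \<Rightarrow> int ^ 'n::finite"
  assumes lam: "0 \<le> lam" "lam < 1" and rw: "biased_rw lam z M X"
  shows "satisfies_LDP (\<lambda>n. distr M borel (\<lambda>\<omega>. scaled_abs n (X n \<omega>)))
    (Lambda_star lam :: real ^ 'n \<Rightarrow> ereal)"
proof -
  have X[measurable]: "X k \<in> measurable M (count_space UNIV)" for k
    using rw by (simp add: biased_rw_def)
  interpret folded_walk M lam "\<lambda>n \<omega>. abs_coords (X n \<omega>)" "abs_coords z"
    by (rule folded_walk_abs_coords[OF rw lam])
  have law: "measure (distr M borel (\<lambda>\<omega>. scaled_abs n (X n \<omega>))) F
      = prob {\<omega> \<in> space M. scaled n (abs_coords (X n \<omega>)) \<in> F}"
    if "F \<in> sets borel" for n and F :: "(real ^ 'n) set"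
  proof -
    have "(\<lambda>\<omega>. scaled_abs n (X n \<omega>)) \<in> borel_measurable M" by measurable
    then show ?thesis
      using that by (simp add: measure_distr scaled_abs_eq vimage_def Int_def conj_commute)
  qed
  show ?thesis
    unfolding satisfies_LDP_def
  proof (intro conjI allI impI)
    fix F :: "(real ^ 'n) set" assume F: "closed F"
    show "limsup (\<lambda>n. ereal (1 / real n) * ext_ln (measure (distr M borel (\<lambda>\<omega>. scaled_abs n (X n \<omega>))) F))
        \<le> - (INF x\<in>F. Lambda_star lam x)"
      using limsup_closed_le[OF F] F by (simp add: law)
  next
    fix G :: "(real ^ 'n) set" assume G: "open G"
    show "- (INF x\<in>G. Lambda_star lam x)
        \<le> liminf (\<lambda>n. ereal (1 / real n) * ext_ln (measure (distr M borel (\<lambda>\<omega>. scaled_abs n (X n \<omega>))) G))"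
      using liminf_open_ge_Lambda_star[OF G] G by (simp add: law)
  qed
qed

section \<open>Closed forms in dimensions one and two\<close>

text \<open>Up to the additive constant \<open>ln 2\<close>, the negative entropy of a coin with mean \<open>x\<close> on the values \<open>1\<close> and
  \<open>-1\<close>; the convex conjugate of \<open>ln cosh\<close>.\<close>

definition coin_entropy :: "real \<Rightarrow> real" where
  "coin_entropy x = ((1 + x) * ln (1 + x) + (1 - x) * ln (1 - x)) / 2"

definition coin :: "real \<Rightarrow> bool \<Rightarrow> real" where
  "coin x b = (if b then (1 + x) / 2 else (1 - x) / 2)"

lemma coin_nonneg: "\<bar>x\<bar> \<le> 1 \<Longrightarrow> 0 \<le> coin x b"
  by (auto simp: coin_def)

lemma sum_coin: "(\<Sum>b\<in>UNIV. coin x b) = 1"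
  by (simp add: UNIV_bool coin_def field_simps)

lemma sum_coin_ln:
  assumes "\<bar>x\<bar> \<le> 1"
  shows "(\<Sum>b\<in>UNIV. coin x b * ln (coin x b)) = coin_entropy x - ln 2"
proof -
  have half: "y / 2 * ln (y / 2) = (y * ln y - y * ln 2) / 2" if "0 \<le> y" for y :: real
    using that by (cases "y = 0") (simp_all add: ln_div field_simps)
  show ?thesis
    using assms half[of "1 + x"] half[of "1 - x"]
    by (simp add: UNIV_bool coin_def coin_entropy_def) (simp add: field_simps)
qed

lemma coin_le:
  assumes "\<bar>x\<bar> \<le> 1"
  shows "u * x - ln (cosh u) \<le> coin_entropy x"
proof -
  have "(\<Sum>b\<in>UNIV. coin x b * (if b then u else - u)) - ln (\<Sum>b\<in>UNIV. exp (if b then u else - u))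
      \<le> (\<Sum>b\<in>UNIV. coin x b * ln (coin x b))"
    by (rule gibbs_le) (use assms coin_nonneg sum_coin in auto)
  moreover have "(\<Sum>b\<in>UNIV. exp (if b then u else - u)) = 2 * cosh u"
    by (simp add: UNIV_bool cosh_field_def)
  moreover have "ln (2 * cosh u) = ln 2 + ln (cosh u)" by (simp add: ln_mult_pos)
  moreover have "(\<Sum>b\<in>UNIV. coin x b * (if b then u else - u)) = u * x"
    by (simp add: UNIV_bool coin_def field_simps)
  ultimately show ?thesis using sum_coin_ln[OF assms] by simp
qed

lemma coin_ge:
  assumes x: "\<bar>x\<bar> \<le> 1" and e: "0 < e"
  obtains u where "coin_entropy x - e \<le> u * x - ln (cosh u)"
proof -
  define a where "a = (1 + x) / 2 + e / 2"
  define b where "b = (1 - x) / 2 + e / 2"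
  have "- 1 \<le> x" "x \<le> 1" using x by auto
  then have pos: "0 < a" "0 < b" using e unfolding a_def b_def by (simp_all add: add_nonneg_pos)
  \<comment> \<open>the Gibbs weights of \<open>u\<close> and \<open>- u\<close> are proportional to \<open>a\<close> and \<open>b\<close>, with \<open>exp c\<close> as the geometric mean\<close>
  define c where "c = (ln a + ln b) / 2"
  define u where "u = (ln a - ln b) / 2"
  have "exp u = exp (ln a - c)" "exp (- u) = exp (ln b - c)"
    by (simp_all add: u_def c_def field_simps)
  then have "exp u = a * exp (- c)" "exp (- u) = b * exp (- c)"
    using pos by (simp_all add: exp_diff exp_minus field_simps)
  then have cosh_u: "cosh u = (a + b) * exp (- c) / 2"
    by (simp add: cosh_field_def distrib_right)
  have "0 < a + b" using pos by simp
  then have ln_cosh: "ln (cosh u) = ln (a + b) - c - ln 2"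
    unfolding cosh_u by (simp add: ln_mult_pos ln_divide_pos)
  have "(\<Sum>b\<in>UNIV. coin x b * ln (coin x b)) - real (card (UNIV :: bool set)) * (e / 2)
      \<le> (\<Sum>b\<in>UNIV. coin x b * ln (coin x b + e / 2)) - ln (\<Sum>b\<in>UNIV. coin x b + e / 2)"
    by (rule gibbs_ge) (use x e coin_nonneg sum_coin in auto)
  moreover have "(\<Sum>b\<in>UNIV. coin x b * ln (coin x b + e / 2)) = (1 + x) / 2 * ln a + (1 - x) / 2 * ln b"
    by (simp add: UNIV_bool coin_def a_def b_def)
  moreover have "(\<Sum>b\<in>UNIV. coin x b + e / 2) = a + b"
    by (simp add: UNIV_bool coin_def a_def b_def)
  ultimately have "coin_entropy x - ln 2 - e \<le> (1 + x) / 2 * ln a + (1 - x) / 2 * ln b - ln (a + b)"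
    using sum_coin_ln[OF x] by simp
  also have "(1 + x) / 2 * ln a + (1 - x) / 2 * ln b = u * x + c"
    by (simp add: u_def c_def field_simps)
  finally show ?thesis using that[of u] ln_cosh by linarith
qed

lemma Lambda_star_dim1:
  fixes x :: "real ^ 'n::finite"
  assumes d: "CARD('n) = 1" and lam: "0 < lam" "lam < 1" and x: "x $ i \<in> {0..1}"
  shows "Lambda_star lam x = ereal (x $ i / 2 * ln lam - ln (rho lam) + coin_entropy (x $ i))"
proof -
  have U: "UNIV = {i}" by (rule card_subset_eq[symmetric]) (use d in auto)
  have sum: "(\<Sum>j\<in>UNIV. f j) = f i" for f :: "'n \<Rightarrow> real" by (simp add: U)
  have nonneg: "0 \<le> x $ j" for j
  proof -
    have "j \<in> {i}" unfolding U[symmetric] by simp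
    then show ?thesis using x by simp
  qed
  have x1: "\<bar>x $ i\<bar> \<le> 1" using x by auto
  have inner: "t \<bullet> x = t $ i * x $ i" for t by (simp add: inner_vec_def sum)
  show ?thesis
  proof (rule antisym)
    have "Lambda_star lam x \<le> ereal ((\<Sum>i\<in>UNIV. x $ i) / 2 * ln lam - ln (rho lam) + coin_entropy (x $ i))"
      by (rule Lambda_star_le_centred[OF lam nonneg]) (simp add: d sum inner coin_le[OF x1])
    then show "Lambda_star lam x \<le> ereal (x $ i / 2 * ln lam - ln (rho lam) + coin_entropy (x $ i))"
      by (simp add: sum)
    show "ereal (x $ i / 2 * ln lam - ln (rho lam) + coin_entropy (x $ i)) \<le> Lambda_star lam x"
    proof (rule ereal_le_epsilon2)
      fix e :: real assume "0 < e"
      then obtain u where u: "coin_entropy (x $ i) - e \<le> u * x $ i - ln (cosh u)"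
        using coin_ge[OF x1] by blast
      let ?t = "(\<chi> i. u) :: real ^ 'n"
      have "ereal (x $ i / 2 * ln lam - ln (rho lam) + coin_entropy (x $ i))
        \<le> ereal ((\<Sum>i\<in>UNIV. x $ i) / 2 * ln lam - ln (rho lam)
          + (?t \<bullet> x - ln ((\<Sum>i\<in>UNIV. cosh (?t $ i)) / real CARD('n)))) + ereal e"
        using u by (simp add: sum inner d)
      also have "\<dots> \<le> Lambda_star lam x + ereal e"
        by (intro add_right_mono Lambda_star_ge_centred lam nonneg)
      finally show "ereal (x $ i / 2 * ln lam - ln (rho lam) + coin_entropy (x $ i))
        \<le> Lambda_star lam x + ereal e" .
    qed
  qed
qed

text \<open>In the coordinates \<open>u = (t1 + t2) / 2\<close> and \<open>v = (t1 - t2) / 2\<close> the two-dimensional symmetric walk is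
  a pair of independent one-dimensional ones.\<close>

lemma Lambda_star_dim2:
  fixes x :: "real ^ 'n::finite"
  assumes d: "CARD('n) = 2" and ij: "i \<noteq> j" and lam: "0 < lam" "lam < 1"
    and x: "0 \<le> x $ i" "0 \<le> x $ j" "x $ i + x $ j \<le> 1"
  shows "Lambda_star lam x = ereal ((x $ i + x $ j) / 2 * ln lam - ln (rho lam)
    + (coin_entropy (x $ i + x $ j) + coin_entropy (x $ i - x $ j)))"
proof -
  have U: "UNIV = {i, j}"
    by (rule card_subset_eq[symmetric]) (use d ij in auto)
  have sum: "(\<Sum>k\<in>UNIV. f k) = f i + f j" for f :: "'n \<Rightarrow> real" using ij by (simp add: U)
  have nonneg: "0 \<le> x $ k" for k
  proof -
    have "k \<in> {i, j}" unfolding U[symmetric] by simp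
    then show ?thesis using x by auto
  qed
  let ?p = "x $ i + x $ j" and ?q = "x $ i - x $ j"
  have pq: "\<bar>?p\<bar> \<le> 1" "\<bar>?q\<bar> \<le> 1" using x by auto
  have split: "t \<bullet> x - ln ((\<Sum>k\<in>UNIV. cosh (t $ k)) / real CARD('n))
      = (u * ?p - ln (cosh u)) + (v * ?q - ln (cosh v))"
    if "u = (t $ i + t $ j) / 2" "v = (t $ i - t $ j) / 2" for t :: "real ^ 'n" and u v
  proof -
    have t: "t $ i = u + v" "t $ j = u - v" using that by (simp_all add: field_simps)
    have "cosh (u + v) + cosh (u - v) = 2 * (cosh u * cosh v)"
      by (simp add: cosh_add cosh_diff)
    then have "ln ((\<Sum>k\<in>UNIV. cosh (t $ k)) / real CARD('n)) = ln (cosh u) + ln (cosh v)"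
      by (simp add: sum t d ln_mult_pos)
    moreover have "t \<bullet> x = u * ?p + v * ?q"
      by (simp add: inner_vec_def sum t algebra_simps)
    ultimately show ?thesis by simp
  qed
  let ?h = "coin_entropy ?p + coin_entropy ?q"
  show ?thesis
  proof (rule antisym)
    have "Lambda_star lam x \<le> ereal ((\<Sum>k\<in>UNIV. x $ k) / 2 * ln lam - ln (rho lam) + ?h)"
    proof (rule Lambda_star_le_centred[OF lam nonneg])
      fix t :: "real ^ 'n"
      show "t \<bullet> x - ln ((\<Sum>k\<in>UNIV. cosh (t $ k)) / real CARD('n)) \<le> ?h"
        unfolding split[OF refl refl] by (intro add_mono coin_le pq)
    qed
    then show "Lambda_star lam x \<le> ereal (?p / 2 * ln lam - ln (rho lam) + ?h)"
      by (simp add: sum)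
    show "ereal (?p / 2 * ln lam - ln (rho lam) + ?h) \<le> Lambda_star lam x"
    proof (rule ereal_le_epsilon2)
      fix e :: real assume e: "0 < e"
      obtain u where u: "coin_entropy ?p - e / 2 \<le> u * ?p - ln (cosh u)"
        using coin_ge[OF pq(1), of "e / 2"] e by auto
      obtain v where v: "coin_entropy ?q - e / 2 \<le> v * ?q - ln (cosh v)"
        using coin_ge[OF pq(2), of "e / 2"] e by auto
      define t :: "real ^ 'n" where "t = (\<chi> k. if k = i then u + v else u - v)"
      have "u = (t $ i + t $ j) / 2" "v = (t $ i - t $ j) / 2"
        using ij by (simp_all add: t_def)
      from split[OF this] have "?h - e \<le> t \<bullet> x - ln ((\<Sum>k\<in>UNIV. cosh (t $ k)) / real CARD('n))"
        using u v by linarith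
      then have "ereal (?p / 2 * ln lam - ln (rho lam) + ?h)
        \<le> ereal ((\<Sum>k\<in>UNIV. x $ k) / 2 * ln lam - ln (rho lam)
          + (t \<bullet> x - ln ((\<Sum>k\<in>UNIV. cosh (t $ k)) / real CARD('n)))) + ereal e"
        unfolding sum[of "\<lambda>k. x $ k"] by simp
      also have "\<dots> \<le> Lambda_star lam x + ereal e"
        by (intro add_right_mono Lambda_star_ge_centred lam nonneg)
      finally show "ereal (?p / 2 * ln lam - ln (rho lam) + ?h) \<le> Lambda_star lam x + ereal e" .
    qed
  qed
qed

text \<open>The square of \<open>D_fun a b\<close> is the product of the four factors \<open>1 \<plusminus> (a + b)\<close> and \<open>1 \<plusminus> (a - b)\<close>, and
  the numerators of the first two logarithms are products of two of them. Collecting the logarithm of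
  each factor gives the entropies.\<close>

lemma Lambda_bar_formula_eq:
  assumes "0 \<le> a" "0 \<le> b" "a + b < 1"
  shows "Lambda_bar_formula a b = coin_entropy (a + b) + coin_entropy (a - b)"
proof -
  define P P' Q Q' where "P = 1 + (a + b)" and "P' = 1 - (a + b)" and "Q = 1 + (a - b)" and "Q' = 1 - (a - b)"
  have pos: "0 < P" "0 < P'" "0 < Q" "0 < Q'"
    using assms by (auto simp: P_def P'_def Q_def Q'_def)
  have D2: "(a\<^sup>2 - b\<^sup>2)\<^sup>2 + 1 - 2 * (a\<^sup>2 + b\<^sup>2) = P * P' * (Q * Q')"
    unfolding P_def P'_def Q_def Q'_def by (simp add: power2_eq_square algebra_simps)
  have "D_fun a b = sqrt (P * P' * (Q * Q'))" by (simp only: D_fun_def D2)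
  then have D: "0 < D_fun a b" "ln (D_fun a b) = (ln P + ln P' + (ln Q + ln Q')) / 2"
    using pos by (simp_all add: ln_sqrt ln_mult_pos)
  have "2 * a + a\<^sup>2 - b\<^sup>2 + 1 = P * Q" "2 * b + b\<^sup>2 - a\<^sup>2 + 1 = P * Q'"
    "(a\<^sup>2 - b\<^sup>2 + 1) + (b\<^sup>2 - a\<^sup>2 + 1) = 2"
    unfolding P_def Q_def Q'_def by (simp_all add: power2_eq_square algebra_simps)
  then have "Lambda_bar_formula a b = a * (ln P + ln Q - ln (D_fun a b)) + b * (ln P + ln Q' - ln (D_fun a b))
      - (ln 2 - ln (D_fun a b)) + ln 2"
    unfolding Lambda_bar_formula_def using pos D(1) by (simp add: ln_mult_pos ln_divide_pos)
  also have "\<dots> = (P * ln P + P' * ln P') / 2 + (Q * ln Q + Q' * ln Q') / 2"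
    unfolding D(2) by (simp add: P_def P'_def Q_def Q'_def field_simps)
  finally show ?thesis by (simp add: coin_entropy_def P_def P'_def Q_def Q'_def)
qed

lemma continuous_on_x_ln_x: "continuous_on {0..} (\<lambda>x :: real. x * ln x)"
  unfolding continuous_on_def
proof
  fix x :: real assume x: "x \<in> {0..}"
  show "((\<lambda>x. x * ln x) \<longlongrightarrow> x * ln x) (at x within {0..})"
  proof (cases "x = 0")
    case True
    have "((\<lambda>x :: real. - (ln x / x)) \<longlongrightarrow> - 0) at_top"
      by (intro tendsto_minus ln_x_over_x_tendsto_0)
    then have "((\<lambda>x :: real. inverse x * ln (inverse x)) \<longlongrightarrow> 0) at_top"
      by (simp add: ln_inverse divide_inverse mult.commute)
    then have "((\<lambda>x :: real. x * ln x) \<longlongrightarrow> 0) (at_right 0)"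
      by (simp only: filterlim_at_right_to_top)
    then show ?thesis
      using True by (simp add: at_within_Ici_at_right)
  next
    case False
    then show ?thesis using x by (intro tendsto_intros) auto
  qed
qed

lemma continuous_on_coin_entropy: "continuous_on {-1..1} coin_entropy"
proof -
  have "continuous_on {-1..1} (\<lambda>x :: real. (\<lambda>y. y * ln y) (1 + x))"
    by (rule continuous_on_compose2[OF continuous_on_x_ln_x]) (auto intro!: continuous_intros)
  moreover have "continuous_on {-1..1} (\<lambda>x :: real. (\<lambda>y. y * ln y) (1 - x))"
    by (rule continuous_on_compose2[OF continuous_on_x_ln_x]) (auto intro!: continuous_intros)
  ultimately show ?thesis
    unfolding coin_entropy_def by (intro continuous_on_divide continuous_on_add continuous_on_const) auto
qed

definition triangle_entropy :: "real \<times> real \<Rightarrow> real" where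
  "triangle_entropy q = coin_entropy (fst q + snd q) + coin_entropy (fst q - snd q)"

lemma continuous_on_triangle_entropy: "continuous_on unit_triangle triangle_entropy"
  unfolding triangle_entropy_def
  by (intro continuous_on_add continuous_on_compose2[OF continuous_on_coin_entropy])
    (auto simp: unit_triangle_def intro!: continuous_intros)

text \<open>The limit in the definition of \<open>Lambda_bar\<close> is meaningful only at accumulation points of the open
  part of the triangle; shrinking towards the origin shows that the hypotenuse consists of such
  points.\<close>

lemma hypotenuse_islimpt:
  assumes p: "p \<in> unit_triangle" "fst p + snd p = 1"
  shows "p islimpt {q \<in> unit_triangle. fst q + snd q < 1}"
  unfolding islimpt_approachable
proof safe
  fix e :: real assume e: "0 < e"
  define \<delta> where "\<delta> = min (1 / 2) (e / 2)"
  have \<delta>: "0 < \<delta>" "\<delta> \<le> 1 / 2" "\<delta> < e" using e by (auto simp: \<delta>_def min_def)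
  let ?q = "(1 - \<delta>) *\<^sub>R p"
  have nonneg: "0 \<le> fst p" "0 \<le> snd p" using p by (auto simp: unit_triangle_def)
  have sum: "fst ?q + snd ?q = 1 - \<delta>"
    using p(2) by (simp add: distrib_left[symmetric])
  have "norm p \<le> norm (fst p) + norm (snd p)" using norm_Pair_le[of "fst p" "snd p"] by simp
  then have norm: "norm p \<le> 1" using nonneg p(2) by simp
  have "?q - p = (- \<delta>) *\<^sub>R p" by (simp add: algebra_simps)
  then have "dist ?q p = \<delta> * norm p" using \<delta> by (simp add: dist_norm)
  also have "\<dots> \<le> \<delta> * 1" using norm \<delta> by (intro mult_left_mono) auto
  finally have "dist ?q p < e" using \<delta> by simp
  moreover have "?q \<in> {q \<in> unit_triangle. fst q + snd q < 1}"
    using nonneg \<delta> sum by (auto simp: unit_triangle_def case_prod_beta)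
  moreover have "?q \<noteq> p"
  proof
    assume "?q = p"
    then have "fst ?q + snd ?q = fst p + snd p" by (simp only:)
    then show False using sum p(2) \<delta> by linarith
  qed
  ultimately show "\<exists>x'\<in>{q \<in> unit_triangle. fst q + snd q < 1}. x' \<noteq> p \<and> dist x' p < e"
    by blast
qed

lemma Lambda_bar_eq:
  assumes p: "p \<in> unit_triangle"
  shows "Lambda_bar p = triangle_entropy p"
proof (cases "fst p + snd p < 1")
  case True
  then show ?thesis
    using p by (auto simp: Lambda_bar_def Lambda_bar_formula_eq triangle_entropy_def unit_triangle_def)
next
  case False
  let ?S = "{q \<in> unit_triangle. fst q + snd q < 1}"
  have one: "fst p + snd p = 1" using False p by (auto simp: unit_triangle_def)
  have "(triangle_entropy \<longlongrightarrow> triangle_entropy p) (at p within ?S)"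
    using continuous_on_triangle_entropy p
    by (auto simp: continuous_on_def intro: tendsto_within_subset)
  moreover have "\<forall>\<^sub>F q in at p within ?S. triangle_entropy q = Lambda_bar_formula (fst q) (snd q)"
    unfolding eventually_at_filter
    by (rule always_eventually)
      (auto simp: unit_triangle_def Lambda_bar_formula_eq triangle_entropy_def)
  ultimately have "((\<lambda>q. Lambda_bar_formula (fst q) (snd q)) \<longlongrightarrow> triangle_entropy p) (at p within ?S)"
    by (simp cong: tendsto_cong)
  moreover have "at p within ?S \<noteq> bot"
    using hypotenuse_islimpt[OF p one] by (simp add: trivial_limit_within)
  ultimately show ?thesis
    using False by (simp add: Lambda_bar_def tendsto_Lim)
qed

theorem theorem3p1:
  fixes lam :: real and z :: "int ^ 'n::finite"
    and M :: "'a measure" and X :: "nat \<Rightarrow> 'a \<Rightarrow> int ^ 'n"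
  assumes lam: "(CARD('n) \<ge> 2 \<and> lam \<in> {0..<1}) \<or> (CARD('n) = 1 \<and> lam \<in> {0<..<1})"
    and rw: "biased_rw lam z M X"
  shows
    "good_rate_function (Lambda_star lam :: real ^ 'n \<Rightarrow> ereal)
     \<and> satisfies_LDP (\<lambda>n. distr M borel (\<lambda>\<omega>. scaled_abs n (X n \<omega>)))
          (Lambda_star lam :: real ^ 'n \<Rightarrow> ereal)
     \<and> (lam \<in> {0<..<1} \<longrightarrow>
          (D_Lambda_star lam :: (real ^ 'n) set)
            = {x. (\<forall>i. 0 \<le> x $ i) \<and> 0 \<le> (\<Sum>i\<in>UNIV. x $ i) \<and> (\<Sum>i\<in>UNIV. x $ i) \<le> 1}
          \<and> {x :: real ^ 'n. Lambda_star lam x = 0}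
            = {\<chi> i. (1 - lam) / (real CARD('n) * (1 + lam))})
     \<and> (CARD('n) \<ge> 2 \<and> lam = 0 \<longrightarrow>
          (D_Lambda_star lam :: (real ^ 'n) set)
            = {x. (\<forall>i. 0 \<le> x $ i) \<and> (\<Sum>i\<in>UNIV. x $ i) = 1}
          \<and> {x :: real ^ 'n. Lambda_star lam x = 0} = {\<chi> i. 1 / real CARD('n)})
     \<and> (CARD('n) = 1 \<and> lam \<in> {0<..<1} \<longrightarrow>
          (\<forall>(x :: real ^ 'n) i.
             (x $ i \<in> {0..1} \<longrightarrow>
                Lambda_star lam x =
                  ereal (x $ i / 2 * ln lam - ln (rho lam)
                         + (1 + x $ i) * ln (sqrt (1 + x $ i))
                         + (1 - x $ i) * ln (sqrt (1 - x $ i))))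
             \<and> (x $ i \<notin> {0..1} \<longrightarrow> Lambda_star lam x = \<infinity>)))
     \<and> (CARD('n) = 2 \<and> lam \<in> {0<..<1} \<longrightarrow>
          continuous_on unit_triangle Lambda_bar
          \<and> (\<forall>(x :: real ^ 'n) i j. i \<noteq> j \<longrightarrow>
               (x \<in> D_Lambda_star lam \<longrightarrow>
                  Lambda_star lam x =
                    ereal (1 / 2 * (x $ i + x $ j) * ln lam - ln (rho lam)
                           + Lambda_bar (x $ i, x $ j)))
               \<and> (x \<notin> D_Lambda_star lam \<longrightarrow> Lambda_star lam x = \<infinity>)))
     \<and> (CARD('n) \<ge> 2 \<and> lam = 0 \<longrightarrow>
          (\<forall>x :: real ^ 'n.
             (x \<in> D_Lambda_star lam \<longrightarrow>
                Lambda_star lam x = ereal (ln (real CARD('n)) + (\<Sum>i\<in>UNIV. x $ i * ln (x $ i))))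
             \<and> (x \<notin> D_Lambda_star lam \<longrightarrow> Lambda_star lam x = \<infinity>)))"
proof -
  have lam': "0 \<le> lam" "lam < 1" using lam by auto
  note fin = Lambda_star_finite_subset[OF lam']
  have zero: "{x :: real ^ 'n. Lambda_star lam x = 0} = {drift lam}"
    using Lambda_star_zero_iff[OF lam'] by auto
  have infinite: "Lambda_star lam x = \<infinity>" if "\<not> Lambda_star lam x < \<infinity>" for x :: "real ^ 'n"
    using that by (simp add: less_top[symmetric] top_ereal_def)
  have domain_pos: "(D_Lambda_star lam :: (real ^ 'n) set)
      = {x. (\<forall>i. 0 \<le> x $ i) \<and> 0 \<le> (\<Sum>i\<in>UNIV. x $ i) \<and> (\<Sum>i\<in>UNIV. x $ i) \<le> 1}"
    if "lam \<in> {0<..<1}"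
  proof -
    have "Lambda_star lam x < \<infinity>
      \<longleftrightarrow> (\<forall>i. 0 \<le> x $ i) \<and> 0 \<le> (\<Sum>i\<in>UNIV. x $ i) \<and> (\<Sum>i\<in>UNIV. x $ i) \<le> 1" for x :: "real ^ 'n"
      using that fin[of x] Lambda_star_finite_pos[of lam x] by (auto intro: sum_nonneg)
    then show ?thesis by (simp only: D_Lambda_star_def)
  qed
  have domain_0: "(D_Lambda_star lam :: (real ^ 'n) set) = {x. (\<forall>i. 0 \<le> x $ i) \<and> (\<Sum>i\<in>UNIV. x $ i) = 1}"
    if "lam = 0"
    unfolding D_Lambda_star_def using that fin(1) Lambda_star_0_finite_sum
    by (auto simp: Lambda_star_0)
  show ?thesis
  proof (intro conjI impI allI)
    show "good_rate_function (Lambda_star lam :: real ^ 'n \<Rightarrow> ereal)"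
      by (rule good_rate_function_Lambda_star[OF lam'])
    show "satisfies_LDP (\<lambda>n. distr M borel (\<lambda>\<omega>. scaled_abs n (X n \<omega>)))
          (Lambda_star lam :: real ^ 'n \<Rightarrow> ereal)"
      by (rule biased_rw_LDP[OF lam' rw])
  next
    assume l: "lam \<in> {0<..<1}"
    show "(D_Lambda_star lam :: (real ^ 'n) set)
      = {x. (\<forall>i. 0 \<le> x $ i) \<and> 0 \<le> (\<Sum>i\<in>UNIV. x $ i) \<and> (\<Sum>i\<in>UNIV. x $ i) \<le> 1}"
      by (rule domain_pos[OF l])
    show "{x :: real ^ 'n. Lambda_star lam x = 0} = {\<chi> i. (1 - lam) / (real CARD('n) * (1 + lam))}"
      unfolding zero drift_def ..
  next
    assume l: "CARD('n) \<ge> 2 \<and> lam = 0"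
    then show "(D_Lambda_star lam :: (real ^ 'n) set) = {x. (\<forall>i. 0 \<le> x $ i) \<and> (\<Sum>i\<in>UNIV. x $ i) = 1}"
      by (intro domain_0) simp
    show "{x :: real ^ 'n. Lambda_star lam x = 0} = {\<chi> i. 1 / real CARD('n)}"
      unfolding zero drift_def using l by simp
  next
    fix x :: "real ^ 'n" and i
    assume l: "CARD('n) = 1 \<and> lam \<in> {0<..<1}" and xi: "x $ i \<in> {0..1}"
    have "coin_entropy (x $ i) = (1 + x $ i) * ln (sqrt (1 + x $ i)) + (1 - x $ i) * ln (sqrt (1 - x $ i))"
    proof -
      have half: "y * ln (sqrt y) = y * ln y / 2" if "0 \<le> y" for y :: real
        using that by (cases "y = 0") (simp_all add: ln_sqrt)
      have plus: "(1 + x $ i) * ln (sqrt (1 + x $ i)) = (1 + x $ i) * ln (1 + x $ i) / 2"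
        by (rule half) (use xi in simp)
      have minus: "(1 - x $ i) * ln (sqrt (1 - x $ i)) = (1 - x $ i) * ln (1 - x $ i) / 2"
        by (rule half) (use xi in simp)
      show ?thesis by (simp only: plus minus coin_entropy_def add_divide_distrib)
    qed
    then show "Lambda_star lam x = ereal (x $ i / 2 * ln lam - ln (rho lam)
                         + (1 + x $ i) * ln (sqrt (1 + x $ i))
                         + (1 - x $ i) * ln (sqrt (1 - x $ i)))"
      using Lambda_star_dim1[of lam x i] l xi by (simp add: add.assoc)
  next
    fix x :: "real ^ 'n" and i
    assume l: "CARD('n) = 1 \<and> lam \<in> {0<..<1}" and xi: "x $ i \<notin> {0..1}"
    show "Lambda_star lam x = \<infinity>"
    proof (rule infinite, rule notI)
      assume f: "Lambda_star lam x < \<infinity>"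
      have "x $ i \<le> (\<Sum>i\<in>UNIV. x $ i)" using fin(1)[OF f] by (intro member_le_sum) auto
      then show False using fin[OF f] xi by (metis atLeastAtMost_iff order_trans)
    qed
  next
    show "continuous_on unit_triangle Lambda_bar"
      by (subst continuous_on_cong[OF refl Lambda_bar_eq]) (auto intro: continuous_on_triangle_entropy)
  next
    fix x :: "real ^ 'n" and i j :: 'n
    assume l: "CARD('n) = 2 \<and> lam \<in> {0<..<1}" and ij: "i \<noteq> j" and x: "x \<in> D_Lambda_star lam"
    have U: "UNIV = {i, j}"
      by (rule card_subset_eq[symmetric]) (use l ij in auto)
    have "0 \<le> x $ i" "0 \<le> x $ j" "(\<Sum>k\<in>UNIV. x $ k) \<le> 1"
      using x fin by (auto simp: D_Lambda_star_def)
    moreover have "(\<Sum>k\<in>UNIV. x $ k) = x $ i + x $ j" using ij by (simp add: U)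
    ultimately have x': "0 \<le> x $ i" "0 \<le> x $ j" "x $ i + x $ j \<le> 1" by auto
    then have "Lambda_bar (x $ i, x $ j) = coin_entropy (x $ i + x $ j) + coin_entropy (x $ i - x $ j)"
      by (subst Lambda_bar_eq) (auto simp: unit_triangle_def triangle_entropy_def)
    then show "Lambda_star lam x = ereal (1 / 2 * (x $ i + x $ j) * ln lam - ln (rho lam)
                           + Lambda_bar (x $ i, x $ j))"
      using Lambda_star_dim2[OF _ ij _ _ x', of lam] l by simp
  next
    fix x :: "real ^ 'n"
    assume "x \<notin> D_Lambda_star lam"
    then show "Lambda_star lam x = \<infinity>" by (intro infinite) (simp add: D_Lambda_star_def)
  next
    fix x :: "real ^ 'n"
    assume "x \<notin> D_Lambda_star lam"
    then show "Lambda_star lam x = \<infinity>" by (intro infinite) (simp add: D_Lambda_star_def)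
  next
    fix x :: "real ^ 'n"
    assume "CARD('n) \<ge> 2 \<and> lam = 0" "x \<in> D_Lambda_star lam"
    then show "Lambda_star lam x = ereal (ln (real CARD('n)) + (\<Sum>i\<in>UNIV. x $ i * ln (x $ i)))"
      using domain_0 by (auto intro: Lambda_star_0)
  qed
qed

end
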